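(* Let $\lambda\neq 0$ and consider the real analytic system $\dot x=y+P(x,y,z)$, $\dot y=Q(x,y,z)$, $\dot z=-\lambda z+R(x,y,z)$, with $j^1P(0)=j^1Q(0)=j^1R(0)=0$. Suppose that the origin is monodromic (on a center manifold) with odd Andreev number $n$ and satisfies the monodromy condition $\beta=n-1$. Then the origin cannot be a center on a center manifold.
   Context: $j^lG(0)$ denotes the $l$-jet of $G$ at $0$. A center manifold is an invariant surface $z=h(x,y)$ through the origin tangent to the $xy$-plane there, with $h$ of class $C^r$ ($r$ any finite integer as large as needed). The restricted planar $C^r$ system is $\dot x=y+p(x,y)$, $\dot y=q(x,y)$ with $p(x,y)=P(x,y,h(x,y))$, $q(x,y)=Q(x,y,h(x,y))$. For it let $y=F(x)$ solve $y+p(x,y)=0$ through the origin, $f(x)=q(x,F(x))$, $\Phi(x)=(\partial_xp+\partial_yq)(x,F(x))$. Write $f(x)=ax^\alpha+O(x^{\alpha+1})$, $a\neq0$, $\alpha<r$, and $\Phi(x)=bx^\beta+O(x^{\beta+1})$, $b\neq 0$ (if $\Phi$ has nonzero jet). The origin is monodromic on the center manifold (orbits turn around it, a first return map is defined) if and only if $a<0$, $\alpha=2n-1$, and either (i) $\beta>n-1$ or the jet of $\Phi$ vanishes, or (ii) $\beta=n-1$ and $b^2+4an<0$. The integer $n$ is the Andreev number; "the monodromy condition $\beta=n-1$" is condition (ii). The origin is a center on a center manifold if, for the restricted system, some punctured neighborhood of the origin is filled with periodic orbits surrounding it. *)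

theory Defs
  imports "HOL-Analysis.Analysis" "HOL-Library.Landau_Symbols"
begin

text \<open>Real analyticity in three variables: near each point of the set, the function is the
  (absolutely convergent) sum of a power series centred at that point.\<close>

definition real_analytic_on3 :: "(real \<times> real \<times> real \<Rightarrow> real) \<Rightarrow> (real \<times> real \<times> real) set \<Rightarrow> bool"
  where "real_analytic_on3 G U \<longleftrightarrow>
    (\<forall>(x0, y0, z0) \<in> U. \<exists>\<rho>>0. \<exists>c :: nat \<times> nat \<times> nat \<Rightarrow> real. \<forall>x y z.
       \<bar>x - x0\<bar> < \<rho> \<and> \<bar>y - y0\<bar> < \<rho> \<and> \<bar>z - z0\<bar> < \<rho> \<longrightarrow>
       ((\<lambda>(i, j, k). c (i, j, k) * (x - x0) ^ i * (y - y0) ^ j * (z - z0) ^ k)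
          has_sum G (x, y, z)) UNIV)"

definition zero_1_jet :: "('a::real_normed_vector \<Rightarrow> real) \<Rightarrow> bool"
  where "zero_1_jet G \<longleftrightarrow> G 0 = 0 \<and> (G has_derivative (\<lambda>_. 0)) (at 0)"

text \<open>\<open>Ck_on k g V\<close>: \<open>g\<close> is of class \<open>C\<^sup>k\<close> on the set \<open>V\<close>, which is meant to be open.\<close>

primrec Ck_on :: "nat \<Rightarrow> (real \<times> real \<Rightarrow> real) \<Rightarrow> (real \<times> real) set \<Rightarrow> bool" where
  "Ck_on 0 g V \<longleftrightarrow> continuous_on V g"
| "Ck_on (Suc k) g V \<longleftrightarrow>
     (\<exists>gx gy. (\<forall>u\<in>V. (g has_derivative (\<lambda>(v, w). gx u * v + gy u * w)) (at u)) \<and>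
              Ck_on k gx V \<and> Ck_on k gy V)"

text \<open>\<open>\<gamma>\<close> solves the autonomous equation with vector field \<open>X\<close> on the interval \<open>I\<close>
  and remains in \<open>D\<close>. Derivatives at endpoints of \<open>I\<close> are one-sided.\<close>

definition solution_in ::
    "('a::real_normed_vector \<Rightarrow> 'a) \<Rightarrow> 'a set \<Rightarrow> real set \<Rightarrow> (real \<Rightarrow> 'a) \<Rightarrow> bool"
  where "solution_in X D I \<gamma> \<longleftrightarrow>
    (\<forall>t\<in>I. \<gamma> t \<in> D \<and> (\<gamma> has_vector_derivative X (\<gamma> t)) (at t within I))"

definition field3 :: "real \<Rightarrow> (real \<times> real \<times> real \<Rightarrow> real) \<Rightarrow> (real \<times> real \<times> real \<Rightarrow> real) \<Rightarrow>
    (real \<times> real \<times> real \<Rightarrow> real) \<Rightarrow> real \<times> real \<times> real \<Rightarrow> real \<times> real \<times> real"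
  where "field3 lam P Q R = (\<lambda>(x, y, z).
    (y + P (x, y, z), Q (x, y, z), - lam * z + R (x, y, z)))"

definition graph_over :: "(real \<times> real \<Rightarrow> real) \<Rightarrow> (real \<times> real) set \<Rightarrow> (real \<times> real \<times> real) set"
  where "graph_over h V = {(x, y, h (x, y)) | x y. (x, y) \<in> V}"

text \<open>Local center manifold \<open>z = h(x,y)\<close>, \<open>(x,y) \<in> V\<close>, of class \<open>C\<^sup>r\<close>, for a field \<open>X\<close> on \<open>U\<close>.
  The last conjunct is local invariance: the orbit through each point of the surface stays on the
  surface for small positive and negative times (the fields considered have unique solutions).\<close>

definition center_manifold :: "(real \<times> real \<times> real \<Rightarrow> real \<times> real \<times> real) \<Rightarrow>
    (real \<times> real \<times> real) set \<Rightarrow> nat \<Rightarrow> (real \<times> real \<Rightarrow> real) \<Rightarrow> (real \<times> real) set \<Rightarrow> bool"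
  where "center_manifold X U r h V \<longleftrightarrow>
    open V \<and> 0 \<in> V \<and> Ck_on r h V \<and> zero_1_jet h \<and> graph_over h V \<subseteq> U \<and>
    (\<forall>m \<in> graph_over h V. \<exists>\<epsilon>>0. \<exists>\<gamma>.
        solution_in X (graph_over h V) {-\<epsilon><..<\<epsilon>} \<gamma> \<and> \<gamma> 0 = m)"

definition restrict_to :: "(real \<times> real \<Rightarrow> real) \<Rightarrow> (real \<times> real \<times> real \<Rightarrow> real) \<Rightarrow> real \<times> real \<Rightarrow> real"
  where "restrict_to h G = (\<lambda>(x, y). G (x, y, h (x, y)))"

definition planar_field ::
    "(real \<times> real \<Rightarrow> real) \<Rightarrow> (real \<times> real \<Rightarrow> real) \<Rightarrow> real \<times> real \<Rightarrow> real \<times> real"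
  where "planar_field p q = (\<lambda>(x, y). (y + p (x, y), q (x, y)))"

text \<open>The planar path \<open>\<gamma>\<close> on \<open>[0,T]\<close> makes one full turn around the origin, expressed by a
  continuous polar angle \<open>\<theta>\<close>.\<close>

definition turns_once :: "(real \<Rightarrow> real \<times> real) \<Rightarrow> real \<Rightarrow> bool"
  where "turns_once \<gamma> T \<longleftrightarrow>
    (\<exists>\<rho> \<theta>. continuous_on {0..T} \<theta> \<and>
       (\<forall>t\<in>{0..T}. \<rho> t > 0 \<and> \<gamma> t = (\<rho> t * cos (\<theta> t), \<rho> t * sin (\<theta> t))) \<and>
       \<bar>\<theta> T - \<theta> 0\<bar> = 2 * pi)"

text \<open>The origin is monodromic for the field \<open>X\<close> on \<open>V\<close>: on some segment issuing from the origin
  and transversal to \<open>X\<close> there is a first return map, along orbits which turn once around the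
  origin and which are arbitrarily close to the origin when they start close enough to it.
  (For the fields \<open>planar_field p q\<close> with \<open>p\<close>, \<open>q\<close> of order at least two, the two halves of the
  \<open>y\<close>-axis are transversal near the origin, so straight segments suffice.)\<close>

definition monodromic :: "(real \<times> real \<Rightarrow> real \<times> real) \<Rightarrow> (real \<times> real) set \<Rightarrow> bool"
  where "monodromic X V \<longleftrightarrow>
    (\<exists>e \<delta>. e \<noteq> 0 \<and> \<delta> > 0 \<and>
       (\<forall>s. 0 < s \<and> s < \<delta> \<longrightarrow>
          s *\<^sub>R e \<in> V \<and> fst e * snd (X (s *\<^sub>R e)) - snd e * fst (X (s *\<^sub>R e)) \<noteq> 0) \<and>
       (\<forall>\<epsilon>>0. \<exists>\<delta>'>0. \<forall>s. 0 < s \<and> s < \<delta>' \<longrightarrow>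
          (\<exists>T>0. \<exists>\<gamma>. solution_in X ((V \<inter> ball 0 \<epsilon>) - {0}) {0..T} \<gamma> \<and>
             \<gamma> 0 = s *\<^sub>R e \<and> \<gamma> T \<in> (\<lambda>u. u *\<^sub>R e) ` {0<..<\<delta>} \<and>
             (\<forall>t. 0 < t \<and> t < T \<longrightarrow> \<gamma> t \<notin> (\<lambda>u. u *\<^sub>R e) ` {0<..<\<delta>}) \<and>
             turns_once \<gamma> T)))"

text \<open>The origin is a center: a punctured neighbourhood consists of periodic orbits surrounding
  the origin.\<close>

definition is_center :: "(real \<times> real \<Rightarrow> real \<times> real) \<Rightarrow> (real \<times> real) set \<Rightarrow> bool"
  where "is_center X V \<longleftrightarrow>
    (\<exists>N. open N \<and> 0 \<in> N \<and> N \<subseteq> V \<and>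
       (\<forall>u \<in> N - {0}. \<exists>\<gamma>. \<exists>T>0. solution_in X (N - {0}) UNIV \<gamma> \<and> \<gamma> 0 = u \<and>
          (\<forall>t. \<gamma> (t + T) = \<gamma> t) \<and> 0 \<in> inside (range \<gamma>)))"

text \<open>The solution \<open>y = F(x)\<close> of \<open>y + p(x,y) = 0\<close> through the origin, as a germ. Continuity at \<open>0\<close>
  selects the branch given by the implicit function theorem.\<close>

definition solves_branch :: "(real \<times> real \<Rightarrow> real) \<Rightarrow> (real \<Rightarrow> real) \<Rightarrow> bool"
  where "solves_branch p F \<longleftrightarrow>
    F 0 = 0 \<and> isCont F 0 \<and> (\<forall>\<^sub>F x in nhds 0. F x + p (x, F x) = 0)"

definition f_along :: "(real \<times> real \<Rightarrow> real) \<Rightarrow> (real \<Rightarrow> real) \<Rightarrow> real \<Rightarrow> real"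
  where "f_along q F x = q (x, F x)"

definition Phi_along ::
    "(real \<times> real \<Rightarrow> real) \<Rightarrow> (real \<times> real \<Rightarrow> real) \<Rightarrow> (real \<Rightarrow> real) \<Rightarrow> real \<Rightarrow> real"
  where "Phi_along p q F x = deriv (\<lambda>s. p (s, F x)) x + deriv (\<lambda>s. q (x, s)) (F x)"

definition leading_term :: "(real \<Rightarrow> real) \<Rightarrow> real \<Rightarrow> nat \<Rightarrow> bool"
  where "leading_term g c k \<longleftrightarrow> c \<noteq> 0 \<and> (\<lambda>x. g x - c * x ^ k) \<in> O[at 0](\<lambda>x. x ^ (k + 1))"

end

theory Submission
  imports Defs
begin

text \<open>Any two center manifolds agree to infinite order at the origin: their difference \<open>d\<close> satisfies
  \<open>d' = (-\<lambda> + o(1)) d\<close> along orbits, whereas \<open>\<sigma> = x\<^sup>2 + K\<^sup>2 y\<^sup>2\<close> changes at a relative rate of at most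
  \<open>2/K\<close>; so for large \<open>K\<close> the quotient \<open>d\<^sup>2/(\<sigma>\<^sup>k + \<eta>)\<close> has no interior maximum, and \<open>\<eta> \<rightarrow> 0\<close> gives
  \<open>d\<^sup>2 \<le> C \<sigma>\<^sup>k\<close>. Hence both restricted systems have the same leading terms, and in the coordinates
  \<open>x\<close>, \<open>Y = y + p(x,y)\<close> they become \<open>x' = Y\<close>, \<open>Y' = a x\<^bsup>2n-1\<^esup> + b x\<^bsup>n-1\<^esup> Y\<close> up to terms of higher
  weight for the weights \<open>(1,n)\<close>. For odd \<open>n\<close> the friction coefficient \<open>b x\<^bsup>n-1\<^esup>\<close> has a constant sign,
  so the energy \<open>Y\<^sup>2/2 - a x\<^bsup>2n\<^esup>/(2n)\<close> is monotone; adding small multiples of \<open>x\<^sup>n Y\<close> and of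
  \<open>x Y\<^bsup>2-1/n\<^esup>\<close>, which have the same weight \<open>2n\<close>, turns it into a strict Lyapunov function whose
  derivative dominates the terms of higher weight. This excludes periodic orbits near the origin.\<close>

section \<open>Power series in three variables\<close>

text \<open>The leading terms are given on the manifold \<open>h\<close>, while a center has to be
  excluded on \<open>h'\<close>; center manifolds are not unique, so the two must be compared, and
  agreement to order 2n is what the argument consumes. With weights 1 for x and n for Y, the main
  part of Y' has weight 2n-1. A remainder of weight 2n is therefore harmless, and Y^2 has exactly
  this weight. Hence a second-order Taylor estimate in the y direction suffices, because the finer
  information in x is carried by f and \<Phi>. This is why all functions pass through one class,
  that of a Lipschitz derivative near 0. The energy changes at the rate b x^(n-1) Y^2, which
  vanishes on both axes; this is the obstacle to using it alone. The multiple of x^n Y repairs the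
  axis Y = 0 by a term x^(3n-1), and that of x Y^(2-1/n) repairs x = 0 by a term |Y|^(3-1/n).
  Substituting Y = t^n, possible for both signs of Y as n is odd, makes every expression polynomial.
  The value n = 1 cannot occur, since \<Phi> vanishes at 0 and so \<beta> > 0.\<close>

lemma summable_exponent_shift:
  fixes c :: "nat \<Rightarrow> real" and e d :: "nat \<Rightarrow> nat"
  assumes "0 < r" "r < s" and sum: "summable (\<lambda>n. \<bar>c n\<bar> * s ^ e n)" and de: "\<And>n. d n \<le> e n"
  shows "summable (\<lambda>n. \<bar>c n * real (d n)\<bar> * r ^ (e n - 1))"
proof -
  \<comment> \<open>The factor produced by differentiation is absorbed by shrinking the radius from
    \<open>s\<close> to \<open>r\<close>.\<close>
  have "(\<lambda>m. real m * (r / s) ^ m) \<longlonglongrightarrow> 0"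
    using assms by (intro powser_times_n_limit_0) auto
  then have "Bseq (\<lambda>m. real m * (r / s) ^ m)"
    by (intro convergent_imp_Bseq) (auto simp: convergent_def)
  then obtain K where K: "\<And>m. norm (real m * (r / s) ^ m) \<le> K"
    by (metis BseqE)
  have bound: "real (d n) * r ^ (e n - 1) \<le> K / r * s ^ e n" for n
  proof (cases "e n")
    \<comment> \<open>Here \<open>e n - 1\<close> truncates to 0, but \<open>d n \<le> e n\<close>
      makes the term vanish.\<close>
    case 0
    have "0 \<le> K" using K[of 0] by simp
    with 0 de[of n] assms show ?thesis by simp
  next
    case (Suc m)
    have "real (e n) * (r / s) ^ e n \<le> K" using K[of "e n"] by simp
    then have "real (e n) * r ^ e n \<le> K * s ^ e n"
      using assms by (simp add: power_divide field_simps)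
    moreover have "real (d n) * r ^ e n \<le> real (e n) * r ^ e n"
      using de[of n] assms by (intro mult_right_mono) auto
    ultimately have "real (d n) * (r ^ m * r) \<le> K * s ^ e n"
      using Suc by (simp add: mult.commute)
    then show ?thesis using assms Suc by (simp add: field_simps)
  qed
  show ?thesis
  proof (rule summable_comparison_test')
    show "summable (\<lambda>n. K / r * (\<bar>c n\<bar> * s ^ e n))" using sum by (rule summable_mult)
    show "norm (\<bar>c n * real (d n)\<bar> * r ^ (e n - 1)) \<le> K / r * (\<bar>c n\<bar> * s ^ e n)" if "n \<ge> 0" for n
      using mult_left_mono[OF bound[of n], of "\<bar>c n\<bar>"] assms
      by (simp add: abs_mult mult_ac)
  qed
qed

definition cube :: "real \<Rightarrow> (real \<times> real \<times> real) set" where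
  "cube s = {- s..s} \<times> {- s..s} \<times> {- s..s}"

definition monom3 :: "nat \<Rightarrow> nat \<Rightarrow> nat \<Rightarrow> real \<times> real \<times> real \<Rightarrow> real" where
  "monom3 i j k u = fst u ^ i * fst (snd u) ^ j * snd (snd u) ^ k"

lemma abs_linear3_le:
  fixes w :: "real \<times> real \<times> real"
  assumes "\<bar>a\<bar> \<le> A" "\<bar>b\<bar> \<le> B" "\<bar>c\<bar> \<le> C"
  shows "\<bar>a * fst w + b * fst (snd w) + c * snd (snd w)\<bar> \<le> (A + B + C) * norm w"
proof -
  obtain x y z where w: "w = (x, y, z)" by (cases w)
  have le: "\<bar>x\<bar> \<le> norm w" "\<bar>y\<bar> \<le> norm w" "\<bar>z\<bar> \<le> norm w"
    using norm_fst_le[of x "(y, z)"] norm_snd_le[of "(y, z)" x] norm_fst_le[of y z] norm_snd_le[of z y]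
    by (auto simp: w)
  have "\<bar>a * x\<bar> \<le> A * norm w" "\<bar>b * y\<bar> \<le> B * norm w" "\<bar>c * z\<bar> \<le> C * norm w"
    unfolding abs_mult using assms le by (meson abs_ge_zero mult_mono order_trans)+
  then show ?thesis unfolding w fst_conv snd_conv distrib_right by linarith
qed

text \<open>The summands may come in any order and repeat exponents, so that termwise differentiation
  needs no reindexing.\<close>

definition power_series_on :: "real \<Rightarrow> (real \<times> real \<times> real \<Rightarrow> real) \<Rightarrow> bool" where
  "power_series_on s G \<longleftrightarrow> (\<exists>c i j k. summable (\<lambda>n. \<bar>c n\<bar> * s ^ (i n + j n + k n)) \<and>
     (\<forall>u\<in>cube s. (\<lambda>n. c n * monom3 (i n) (j n) (k n) u) sums G u))"

lemma abs_monom3_le: "u \<in> cube s \<Longrightarrow> \<bar>monom3 i j k u\<bar> \<le> s ^ (i + j + k)"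
  unfolding cube_def monom3_def
  by (auto simp: abs_mult power_abs power_add intro!: mult_mono power_mono)

lemma power_series_on_bounded:
  assumes "power_series_on s G"
  obtains M where "\<And>u. u \<in> cube s \<Longrightarrow> \<bar>G u\<bar> \<le> M"
proof -
  from assms obtain c i j k where sum: "summable (\<lambda>n. \<bar>c n\<bar> * s ^ (i n + j n + k n))"
    and G: "\<And>u. u \<in> cube s \<Longrightarrow> (\<lambda>n. c n * monom3 (i n) (j n) (k n) u) sums G u"
    unfolding power_series_on_def by blast
  have "\<bar>G u\<bar> \<le> (\<Sum>n. \<bar>c n\<bar> * s ^ (i n + j n + k n))" if "u \<in> cube s" for u
  proof -
    have *: "norm (c n * monom3 (i n) (j n) (k n) u) \<le> \<bar>c n\<bar> * s ^ (i n + j n + k n)" for n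
      using abs_monom3_le[OF that] by (simp add: abs_mult mult_left_mono)
    have "norm (suminf (\<lambda>n. c n * monom3 (i n) (j n) (k n) u)) \<le> (\<Sum>n. \<bar>c n\<bar> * s ^ (i n + j n + k n))"
      by (rule norm_suminf_le[OF * sum])
    with sums_unique[OF G[OF that]] show ?thesis by simp
  qed
  then show ?thesis by (rule that)
qed

lemma power_series_onI:
  assumes "summable (\<lambda>n. \<bar>c n\<bar> * s ^ (i n + j n + k n))"
  shows "power_series_on s (\<lambda>u. \<Sum>n. c n * monom3 (i n) (j n) (k n) u)"
proof -
  have "(\<lambda>n. c n * monom3 (i n) (j n) (k n) u) sums (\<Sum>n. c n * monom3 (i n) (j n) (k n) u)"
    if "u \<in> cube s" for u
  proof (rule summable_sums, rule summable_comparison_test'[OF assms])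
    show "norm (c n * monom3 (i n) (j n) (k n) u) \<le> \<bar>c n\<bar> * s ^ (i n + j n + k n)" if "n \<ge> 0" for n
      using abs_monom3_le[OF \<open>u \<in> cube s\<close>] by (simp add: abs_mult mult_left_mono)
  qed
  with assms show ?thesis unfolding power_series_on_def by blast
qed

lemma abs_monom3_le_pred:
  assumes "u \<in> cube s" "0 < s" "i + j + k = m - 1"
  shows "\<bar>monom3 i j k u\<bar> \<le> s ^ (m - 1)"
  using abs_monom3_le[OF assms(1), of i j k] assms(3) by simp

lemma has_derivative_monom3:
  "(monom3 i j k has_derivative (\<lambda>w.
      real i * monom3 (i - 1) j k u * fst w + real j * monom3 i (j - 1) k u * fst (snd w)
      + real k * monom3 i j (k - 1) u * snd (snd w))) (at u within S)"
  unfolding monom3_def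
  by (auto intro!: derivative_eq_intros simp: algebra_simps)

text \<open>Termwise differentiation costs an arbitrarily small part of the radius. The partial
  derivatives are returned as power series again, so that the result can be applied to them in
  turn.\<close>

lemma power_series_on_has_derivative:
  assumes G: "power_series_on s G" and rs: "0 < r" "r < s"
  obtains Gx Gy Gz where "power_series_on r Gx" "power_series_on r Gy" "power_series_on r Gz"
    "\<And>u. u \<in> cube r \<Longrightarrow>
       (G has_derivative (\<lambda>w. Gx u * fst w + Gy u * fst (snd w) + Gz u * snd (snd w))) (at u within cube r)"
proof -
  from G obtain c i j k where sum: "summable (\<lambda>n. \<bar>c n\<bar> * s ^ (i n + j n + k n))"
    and G: "\<And>u. u \<in> cube s \<Longrightarrow> (\<lambda>n. c n * monom3 (i n) (j n) (k n) u) sums G u"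
    unfolding power_series_on_def by blast
  define e where "e n = i n + j n + k n" for n
  define m where "m d n = \<bar>c n * real (d n)\<bar> * r ^ (e n - 1)" for d :: "nat \<Rightarrow> nat" and n
  have msum: "summable (m d)" if "\<And>n. d n \<le> e n" for d
    unfolding m_def using summable_exponent_shift[OF rs, of c e d] sum that by (simp add: e_def)
  have mi: "summable (m i)" and mj: "summable (m j)" and mk: "summable (m k)"
    by (auto intro!: msum simp: e_def)
  define fx where "fx n = (\<lambda>u. c n * real (i n) * monom3 (i n - 1) (j n) (k n) u)" for n
  define fy where "fy n = (\<lambda>u. c n * real (j n) * monom3 (i n) (j n - 1) (k n) u)" for n
  define fz where "fz n = (\<lambda>u. c n * real (k n) * monom3 (i n) (j n) (k n - 1) u)" for n
  have bx: "\<bar>fx n u\<bar> \<le> m i n" and bY: "\<bar>fy n u\<bar> \<le> m j n" and bz: "\<bar>fz n u\<bar> \<le> m k n"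
    if "u \<in> cube r" for n u
  proof -
    show "\<bar>fx n u\<bar> \<le> m i n"
      unfolding fx_def m_def abs_mult[of "_ * _"]
    \<comment> \<open>If \<open>i n = 0\<close> the coefficient vanishes; otherwise the exponents of
      the differentiated monomial add up to \<open>e n - 1\<close> without truncation. The other two
      variables are alike.\<close>
    proof (cases "i n")
      case (Suc l)
      then show "\<bar>c n * real (i n)\<bar> * \<bar>monom3 (i n - 1) (j n) (k n) u\<bar> \<le> \<bar>c n * real (i n)\<bar> * r ^ (e n - 1)"
        using that rs by (intro mult_left_mono abs_monom3_le_pred) (auto simp: e_def)
    qed auto
    show "\<bar>fy n u\<bar> \<le> m j n"
      unfolding fy_def m_def abs_mult[of "_ * _"]
    proof (cases "j n")
      case (Suc l)
      then show "\<bar>c n * real (j n)\<bar> * \<bar>monom3 (i n) (j n - 1) (k n) u\<bar> \<le> \<bar>c n * real (j n)\<bar> * r ^ (e n - 1)"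
        using that rs by (intro mult_left_mono abs_monom3_le_pred) (auto simp: e_def)
    qed auto
    show "\<bar>fz n u\<bar> \<le> m k n"
      unfolding fz_def m_def abs_mult[of "_ * _"]
    proof (cases "k n")
      case (Suc l)
      then show "\<bar>c n * real (k n)\<bar> * \<bar>monom3 (i n) (j n) (k n - 1) u\<bar> \<le> \<bar>c n * real (k n)\<bar> * r ^ (e n - 1)"
        using that rs by (intro mult_left_mono abs_monom3_le_pred) (auto simp: e_def)
    qed auto
  qed
  define Gx where "Gx u = (\<Sum>n. fx n u)" for u
  define Gy where "Gy u = (\<Sum>n. fy n u)" for u
  define Gz where "Gz u = (\<Sum>n. fz n u)" for u
  have psx: "power_series_on r Gx"
    unfolding Gx_def fx_def
  proof (intro power_series_onI)
    show "summable (\<lambda>n. \<bar>c n * real (i n)\<bar> * r ^ (i n - 1 + j n + k n))"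
    proof (rule summable_comparison_test'[OF mi])
      show "norm (\<bar>c n * real (i n)\<bar> * r ^ (i n - 1 + j n + k n)) \<le> m i n" if "n \<ge> 0" for n
        using rs unfolding m_def by (cases "i n") (auto simp: e_def)
    qed
  qed
  have psy: "power_series_on r Gy"
    unfolding Gy_def fy_def
  proof (intro power_series_onI)
    show "summable (\<lambda>n. \<bar>c n * real (j n)\<bar> * r ^ (i n + (j n - 1) + k n))"
    proof (rule summable_comparison_test'[OF mj])
      show "norm (\<bar>c n * real (j n)\<bar> * r ^ (i n + (j n - 1) + k n)) \<le> m j n" if "n \<ge> 0" for n
        using rs unfolding m_def by (cases "j n") (auto simp: e_def)
    qed
  qed
  have psz: "power_series_on r Gz"
    unfolding Gz_def fz_def
  proof (intro power_series_onI)
    show "summable (\<lambda>n. \<bar>c n * real (k n)\<bar> * r ^ (i n + j n + (k n - 1)))"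
    proof (rule summable_comparison_test'[OF mk])
      show "norm (\<bar>c n * real (k n)\<bar> * r ^ (i n + j n + (k n - 1))) \<le> m k n" if "n \<ge> 0" for n
        using rs unfolding m_def by (cases "k n") (auto simp: e_def)
    qed
  qed
  define f' where "f' n u w = fx n u * fst w + fy n u * fst (snd w) + fz n u * snd (snd w)"
    for n and u w :: "real \<times> real \<times> real"
  define g' where "g' u w = Gx u * fst w + Gy u * fst (snd w) + Gz u * snd (snd w)"
    for u w :: "real \<times> real \<times> real"
  define M where "M n = m i n + m j n + m k n" for n
  have M: "summable M" unfolding M_def by (intro summable_add mi mj mk)
  have f'_bound: "norm (f' n u w) \<le> M n * norm w" if "u \<in> cube r" for n u w
  proof -
    show ?thesis
      unfolding f'_def M_def real_norm_def by (rule abs_linear3_le[OF bx bY bz]; rule that)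
  qed
  have f'_sums: "(\<lambda>n. f' n u w) sums g' u w" if "u \<in> cube r" for u w
  proof -
    have "summable (\<lambda>n. fx n u)" "summable (\<lambda>n. fy n u)" "summable (\<lambda>n. fz n u)"
      using bx[OF that] bY[OF that] bz[OF that]
      by (auto intro: summable_comparison_test'[OF mi] summable_comparison_test'[OF mj]
          summable_comparison_test'[OF mk])
    then show ?thesis
      unfolding f'_def g'_def Gx_def Gy_def Gz_def
      by (intro sums_add sums_mult2 summable_sums)
  qed
  have "\<exists>g. \<forall>u\<in>cube r. (\<lambda>n. c n * monom3 (i n) (j n) (k n) u) sums g u \<and>
      (g has_derivative g' u) (at u within cube r)"
  proof (rule has_derivative_series)
    show "convex (cube r)" unfolding cube_def by (intro convex_Times convex_real_interval)
    show "((\<lambda>u. c n * monom3 (i n) (j n) (k n) u) has_derivative f' n u) (at u within cube r)" for n u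
      unfolding f'_def fx_def fy_def fz_def
      by (rule has_derivative_eq_rhs[OF has_derivative_mult_right[OF has_derivative_monom3]])
         (simp add: algebra_simps)
    show "(0, 0, 0) \<in> cube r" using rs by (simp add: cube_def)
    show "(\<lambda>n. c n * monom3 (i n) (j n) (k n) (0, 0, 0)) sums G (0, 0, 0)"
      using rs by (intro G) (simp add: cube_def)
    fix \<epsilon> :: real assume "\<epsilon> > 0"
    \<comment> \<open>The tails of the majorant \<open>M\<close> bound the remainder of the
      differentiated series uniformly on the cube.\<close>
    have "(\<lambda>n. \<Sum>l. M (l + n)) \<longlonglongrightarrow> 0" by (rule suminf_exist_split2[OF M])
    then have "\<forall>\<^sub>F n in sequentially. (\<Sum>l. M (l + n)) < \<epsilon>"
      using \<open>\<epsilon> > 0\<close> by (rule order_tendstoD)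
    then show "\<forall>\<^sub>F n in sequentially. \<forall>u\<in>cube r. \<forall>w. norm ((\<Sum>l<n. f' l u w) - g' u w) \<le> \<epsilon> * norm w"
    proof (eventually_elim, intro ballI allI)
      fix n u w assume n: "(\<Sum>l. M (l + n)) < \<epsilon>" and u: "u \<in> cube r"
      have sf: "summable (\<lambda>l. f' l u w)" using f'_sums[OF u] by (rule sums_summable)
      have "g' u w = (\<Sum>l. f' (l + n) u w) + (\<Sum>l<n. f' l u w)"
        using suminf_split_initial_segment[OF sf, of n] sums_unique[OF f'_sums[OF u]] by simp
      then have "norm ((\<Sum>l<n. f' l u w) - g' u w) = norm (\<Sum>l. f' (l + n) u w)" by simp
      also have "\<dots> \<le> (\<Sum>l. M (l + n) * norm w)"
        by (intro norm_suminf_le f'_bound u summable_mult2) (use M in \<open>simp add: summable_iff_shift\<close>)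
      also have "\<dots> = (\<Sum>l. M (l + n)) * norm w"
        using M by (intro suminf_mult2[symmetric]) (simp add: summable_iff_shift)
      also have "\<dots> \<le> \<epsilon> * norm w" using n by (intro mult_right_mono) auto
      finally show "norm ((\<Sum>l<n. f' l u w) - g' u w) \<le> \<epsilon> * norm w" .
    qed
  qed
  then obtain g where g: "\<And>u. u \<in> cube r \<Longrightarrow> (\<lambda>n. c n * monom3 (i n) (j n) (k n) u) sums g u"
    "\<And>u. u \<in> cube r \<Longrightarrow> (g has_derivative g' u) (at u within cube r)" by blast
  have "cube r \<subseteq> cube s" using rs by (auto simp: cube_def)
  then have gG: "g u = G u" if "u \<in> cube r" for u
    using sums_unique2[OF g(1)[OF that] G] that by blast
  have "(G has_derivative g' u) (at u within cube r)" if "u \<in> cube r" for u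
    by (rule has_derivative_transform[OF that _ g(2)[OF that]]) (simp add: gG)
  then show ?thesis using that[OF psx psy psz] unfolding g'_def by blast
qed

text \<open>This class contains analytic functions as well as C^2 functions such as
  \<open>h\<close>, is stable under restriction to a graph, and carries a quadratic Taylor
  remainder.\<close>

definition C11_near_0 :: "('a::real_normed_vector \<Rightarrow> real) \<Rightarrow> ('a \<Rightarrow> 'a \<Rightarrow> real) \<Rightarrow> bool" where
  "C11_near_0 G D \<longleftrightarrow> (\<exists>\<epsilon>>0. \<exists>L. \<forall>u\<in>ball 0 \<epsilon>. (G has_derivative D u) (at u) \<and>
     (\<forall>v\<in>ball 0 \<epsilon>. \<forall>w. \<bar>D u w - D v w\<bar> \<le> L * norm (u - v) * norm w))"

lemma ball_subset_cube: "ball 0 r \<subseteq> interior (cube r)"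
proof (rule interior_maximal)
  show "ball 0 r \<subseteq> cube r"
  proof
    fix u :: "real \<times> real \<times> real" assume "u \<in> ball 0 r"
    moreover obtain x y z where "u = (x, y, z)" by (cases u)
    ultimately show "u \<in> cube r"
      using norm_fst_le[of x "(y, z)"] norm_snd_le[of "(y, z)" x] norm_fst_le[of y z] norm_snd_le[of z y]
      by (auto simp: cube_def)
  qed
qed auto

lemma power_series_on_lipschitz:
  assumes "power_series_on s G" "0 < r" "r < s"
  obtains L where "L \<ge> 0" "\<And>u v. u \<in> cube r \<Longrightarrow> v \<in> cube r \<Longrightarrow> \<bar>G u - G v\<bar> \<le> L * norm (u - v)"
proof -
  obtain Gx Gy Gz where ps: "power_series_on r Gx" "power_series_on r Gy" "power_series_on r Gz"
    and G: "\<And>u. u \<in> cube r \<Longrightarrow>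
       (G has_derivative (\<lambda>w. Gx u * fst w + Gy u * fst (snd w) + Gz u * snd (snd w))) (at u within cube r)"
    using power_series_on_has_derivative[OF assms] by blast
  obtain A B C where A: "\<And>u. u \<in> cube r \<Longrightarrow> \<bar>Gx u\<bar> \<le> A" and B: "\<And>u. u \<in> cube r \<Longrightarrow> \<bar>Gy u\<bar> \<le> B"
    and C: "\<And>u. u \<in> cube r \<Longrightarrow> \<bar>Gz u\<bar> \<le> C"
    using ps[THEN power_series_on_bounded] by metis
  have "(0, 0, 0) \<in> cube r" using assms by (simp add: cube_def)
  from A[OF this] B[OF this] C[OF this] have nn: "0 \<le> A" "0 \<le> B" "0 \<le> C" by auto
  have "norm (G u - G v) \<le> (A + B + C) * norm (u - v)" if "u \<in> cube r" "v \<in> cube r" for u v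
  proof (rule differentiable_bound[OF _ G _ that])
    show "convex (cube r)" unfolding cube_def by (intro convex_Times convex_real_interval)
    fix u assume u: "u \<in> cube r"
    show "onorm (\<lambda>w. Gx u * fst w + Gy u * fst (snd w) + Gz u * snd (snd w)) \<le> A + B + C"
      by (rule onorm_le) (use abs_linear3_le[OF A[OF u] B[OF u] C[OF u]] in simp)
  qed
  with nn show ?thesis by (intro that[of "A + B + C"]) auto
qed

lemma power_series_on_C11:
  assumes "power_series_on s G" "0 < s"
  shows "\<exists>D. C11_near_0 G D"
proof -
  \<comment> \<open>One halving of the radius pays for differentiating \<open>G\<close>, a second
    one for the Lipschitz bounds of the partial derivatives.\<close>
  obtain Gx Gy Gz where ps: "power_series_on (s/2) Gx" "power_series_on (s/2) Gy" "power_series_on (s/2) Gz"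
    and G: "\<And>u. u \<in> cube (s/2) \<Longrightarrow>
       (G has_derivative (\<lambda>w. Gx u * fst w + Gy u * fst (snd w) + Gz u * snd (snd w))) (at u within cube (s/2))"
    using power_series_on_has_derivative[OF assms(1), of "s/2"] assms(2) by auto
  let ?r = "s/4"
  have r: "0 < ?r" "?r < s/2" using assms by auto
  obtain A B C where nn: "A \<ge> 0" "B \<ge> 0" "C \<ge> 0"
    and A: "\<And>u v. u \<in> cube ?r \<Longrightarrow> v \<in> cube ?r \<Longrightarrow> \<bar>Gx u - Gx v\<bar> \<le> A * norm (u - v)"
    and B: "\<And>u v. u \<in> cube ?r \<Longrightarrow> v \<in> cube ?r \<Longrightarrow> \<bar>Gy u - Gy v\<bar> \<le> B * norm (u - v)"
    and C: "\<And>u v. u \<in> cube ?r \<Longrightarrow> v \<in> cube ?r \<Longrightarrow> \<bar>Gz u - Gz v\<bar> \<le> C * norm (u - v)"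
    using power_series_on_lipschitz[OF ps(1) r] power_series_on_lipschitz[OF ps(2) r]
      power_series_on_lipschitz[OF ps(3) r] by metis
  define D where "D u w = Gx u * fst w + Gy u * fst (snd w) + Gz u * snd (snd w)"
    for u w :: "real \<times> real \<times> real"
  have "(G has_derivative D u) (at u)" if "u \<in> ball 0 ?r" for u
  proof -
    have "u \<in> ball 0 (s/2)" using that r by auto
    then have "u \<in> interior (cube (s/2))" using ball_subset_cube by blast
    moreover from this have "u \<in> cube (s/2)" using interior_subset by blast
    ultimately show ?thesis using G[of u] at_within_interior[of u "cube (s/2)"] by (simp add: D_def[abs_def])
  qed
  moreover have "\<bar>D u w - D v w\<bar> \<le> (A + B + C) * norm (u - v) * norm w"
    if uv: "u \<in> ball 0 ?r" "v \<in> ball 0 ?r" for u v w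
  proof -
    have uv: "u \<in> cube ?r" "v \<in> cube ?r"
      using uv ball_subset_cube[of ?r] interior_subset[of "cube ?r"] by auto
    have "D u w - D v w = (Gx u - Gx v) * fst w + (Gy u - Gy v) * fst (snd w) + (Gz u - Gz v) * snd (snd w)"
      by (simp add: D_def algebra_simps)
    also have "\<bar>\<dots>\<bar> \<le> (A * norm (u - v) + B * norm (u - v) + C * norm (u - v)) * norm w"
      by (rule abs_linear3_le[OF A[OF uv] B[OF uv] C[OF uv]])
    finally show ?thesis by (simp add: algebra_simps)
  qed
  ultimately show ?thesis unfolding C11_near_0_def using r by blast
qed

lemma real_analytic_C11:
  assumes "real_analytic_on3 G U" "0 \<in> U"
  shows "\<exists>D. C11_near_0 G D"
proof -
  from assms obtain \<rho> c where \<rho>: "\<rho> > 0" and G: "\<And>x y z. \<bar>x\<bar> < \<rho> \<Longrightarrow> \<bar>y\<bar> < \<rho> \<Longrightarrow> \<bar>z\<bar> < \<rho> \<Longrightarrow>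
      ((\<lambda>(i, j, k). c (i, j, k) * x ^ i * y ^ j * z ^ k) has_sum G (x, y, z)) UNIV"
    unfolding real_analytic_on3_def zero_prod_def by fastforce
  \<comment> \<open>An enumeration of the exponent triples turns the unordered sum into an ordinary
    series; this is what the free exponents in \<open>power_series_on\<close> are made for.\<close>
  define ex where "ex n = (case prod_decode n of (i, m) \<Rightarrow> (i, prod_decode m))" for n
  have ex: "bij ex"
  proof (rule bij_betw_byWitness[where f' = "\<lambda>(i, p). prod_encode (i, prod_encode p)"])
  qed (auto simp: ex_def split: prod.splits simp: prod_decode_inverse, metis prod_decode_inverse)
  define i where "i n = fst (ex n)" for n
  define j where "j n = fst (snd (ex n))" for n
  define k where "k n = snd (snd (ex n))" for n
  define s where "s = \<rho> / 2"
  have s: "0 < s" "s < \<rho>" using \<rho> by (auto simp: s_def)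
  have hs: "((\<lambda>n. c (ex n) * x ^ i n * y ^ j n * z ^ k n) has_sum G (x, y, z)) UNIV"
    if "\<bar>x\<bar> < \<rho>" "\<bar>y\<bar> < \<rho>" "\<bar>z\<bar> < \<rho>" for x y z
    using G[OF that] has_sum_reindex_bij_betw[OF ex, of "\<lambda>(i, j, k). c (i, j, k) * x ^ i * y ^ j * z ^ k"]
    by (simp add: case_prod_unfold i_def j_def k_def)
  have "power_series_on s G"
    unfolding power_series_on_def
  proof (intro exI conjI ballI)
    \<comment> \<open>Summability at the corner (s, s, s) is unconditional, hence absolute, and
      dominates the series on the whole cube.\<close>
    have "(\<lambda>n. norm (c (ex n) * s ^ i n * s ^ j n * s ^ k n)) summable_on UNIV"
      using hs[of s s s] s has_sum_imp_summable summable_on_iff_abs_summable_on_real by fastforce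
    then have "summable (\<lambda>n. norm (c (ex n) * s ^ i n * s ^ j n * s ^ k n))"
      by (rule summable_on_imp_summable)
    then show "summable (\<lambda>n. \<bar>c (ex n)\<bar> * s ^ (i n + j n + k n))"
      using s by (simp add: abs_mult power_add mult_ac)
    fix u assume "u \<in> cube s"
    then have "(\<lambda>n. c (ex n) * fst u ^ i n * fst (snd u) ^ j n * snd (snd u) ^ k n) sums G (fst u, fst (snd u), snd (snd u))"
      using s by (intro has_sum_imp_sums hs) (auto simp: cube_def)
    then show "(\<lambda>n. c (ex n) * monom3 (i n) (j n) (k n) u) sums G u"
      by (simp add: monom3_def mult_ac)
  qed
  from power_series_on_C11[OF this s(1)] show ?thesis .
qed

section \<open>Functions with Lipschitz derivative near the origin\<close>

text \<open>The witnesses of \<open>C11_near_0\<close> are made explicit, so that several functions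
  can share them; \<open>L\<close> is positive so that radii such as 1/L make sense.\<close>

definition C11_ball :: "real \<Rightarrow> real \<Rightarrow> ('a::real_normed_vector \<Rightarrow> real) \<Rightarrow> ('a \<Rightarrow> 'a \<Rightarrow> real) \<Rightarrow> bool" where
  "C11_ball \<epsilon> L G D \<longleftrightarrow> \<epsilon> > 0 \<and> L > 0 \<and> (\<forall>u\<in>ball 0 \<epsilon>. (G has_derivative D u) (at u) \<and>
     (\<forall>v\<in>ball 0 \<epsilon>. \<forall>w. \<bar>D u w - D v w\<bar> \<le> L * norm (u - v) * norm w))"

lemma C11_near_0_imp_ball:
  assumes "C11_near_0 G D"
  obtains \<epsilon> L where "C11_ball \<epsilon> L G D"
proof -
  from assms obtain \<epsilon> L where \<epsilon>: "\<epsilon> > 0" "\<And>u. u \<in> ball 0 \<epsilon> \<Longrightarrow> (G has_derivative D u) (at u)"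
    and L: "\<And>u v w. u \<in> ball 0 \<epsilon> \<Longrightarrow> v \<in> ball 0 \<epsilon> \<Longrightarrow> \<bar>D u w - D v w\<bar> \<le> L * norm (u - v) * norm w"
    unfolding C11_near_0_def by blast
  have "\<bar>D u w - D v w\<bar> \<le> max L 1 * norm (u - v) * norm w" if "u \<in> ball 0 \<epsilon>" "v \<in> ball 0 \<epsilon>" for u v w
    by (rule order_trans[OF L[OF that]]) (auto intro!: mult_right_mono)
  with \<epsilon> have "C11_ball \<epsilon> (max L 1) G D" unfolding C11_ball_def by auto
  then show ?thesis by (rule that)
qed

lemma C11_ball_mono:
  assumes "C11_ball \<epsilon> L G D" "0 < \<epsilon>'" "\<epsilon>' \<le> \<epsilon>" "L \<le> L'"
  shows "C11_ball \<epsilon>' L' G D"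
proof -
  have "\<bar>D u w - D v w\<bar> \<le> L' * norm (u - v) * norm w" if "u \<in> ball 0 \<epsilon>'" "v \<in> ball 0 \<epsilon>'" for u v w
  proof -
    have "\<bar>D u w - D v w\<bar> \<le> L * norm (u - v) * norm w"
      using assms(1,3) that by (auto simp: C11_ball_def)
    also have "\<dots> \<le> L' * norm (u - v) * norm w"
      using assms(4) by (intro mult_right_mono) auto
    finally show ?thesis .
  qed
  then show ?thesis using assms by (auto simp: C11_ball_def)
qed

lemma C11_ball_common:
  assumes "C11_near_0 G D" "C11_near_0 G' D'"
  obtains \<epsilon> L where "C11_ball \<epsilon> L G D" "C11_ball \<epsilon> L G' D'"
proof -
  obtain \<epsilon>1 L1 \<epsilon>2 L2 where *: "C11_ball \<epsilon>1 L1 G D" "C11_ball \<epsilon>2 L2 G' D'"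
    using assms C11_near_0_imp_ball by metis
  moreover from * have "\<epsilon>1 > 0" "\<epsilon>2 > 0" by (auto simp: C11_ball_def)
  ultimately show ?thesis
    by (intro that[of "min \<epsilon>1 \<epsilon>2" "max L1 L2"]) (erule C11_ball_mono; simp)+
qed

context
  fixes \<epsilon> L :: real and G :: "'a::real_normed_vector \<Rightarrow> real" and D
  assumes C11: "C11_ball \<epsilon> L G D"
begin

lemma C11_ball_pos: "\<epsilon> > 0" "L > 0"
  using C11 by (auto simp: C11_ball_def)

lemma C11_ball_has_derivative: "u \<in> ball 0 \<epsilon> \<Longrightarrow> (G has_derivative D u) (at u)"
  using C11 by (auto simp: C11_ball_def)

lemma C11_ball_lipschitz:
  "u \<in> ball 0 \<epsilon> \<Longrightarrow> v \<in> ball 0 \<epsilon> \<Longrightarrow> \<bar>D u w - D v w\<bar> \<le> L * norm (u - v) * norm w"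
  using C11 by (auto simp: C11_ball_def)

lemma C11_ball_taylor:
  assumes "u \<in> ball 0 \<epsilon>" "v \<in> ball 0 \<epsilon>"
  shows "\<bar>G v - G u - D u (v - u)\<bar> \<le> L * norm (v - u) ^ 2"
proof -
  have seg: "closed_segment u v \<subseteq> ball 0 \<epsilon>" using assms by (intro closed_segment_subset) auto
  have "norm (G v - G u - D u (v - u)) \<le> norm (v - u) * (L * norm (v - u))"
  proof (rule differentiable_bound_linearization)
    show "u + t *\<^sub>R (v - u) \<in> closed_segment u v" if "t \<in> {0..1}" for t
      using that by (auto simp: in_segment algebra_simps intro!: exI[of _ t])
    show "(G has_derivative D x) (at x within closed_segment u v)" if "x \<in> closed_segment u v" for x
      using C11_ball_has_derivative that seg by (blast intro: has_derivative_at_withinI)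
    show "onorm (D x - D u) \<le> L * norm (v - u)" if x: "x \<in> closed_segment u v" for x
    proof (rule onorm_bound)
      fix w :: 'a
      have "norm ((D x - D u) w) \<le> L * norm (x - u) * norm w"
        using C11_ball_lipschitz[of x u w] x seg assms(1) by auto
      also have "\<dots> \<le> L * norm (v - u) * norm w"
        using segment_bound(1)[OF x] C11_ball_pos by (intro mult_right_mono mult_left_mono) auto
      finally show "norm ((D x - D u) w) \<le> L * norm (v - u) * norm w" .
    qed (use C11_ball_pos in auto)
  qed auto
  then show ?thesis by (simp add: power2_eq_square mult_ac)
qed

context
  assumes jet: "zero_1_jet G"
begin

lemma C11_ball_deriv_0: "D 0 = (\<lambda>_. 0)"
  using jet C11_ball_has_derivative[of 0] C11_ball_pos
  by (auto simp: zero_1_jet_def intro: has_derivative_unique)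

lemma C11_ball_deriv_le: "u \<in> ball 0 \<epsilon> \<Longrightarrow> \<bar>D u w\<bar> \<le> L * norm u * norm w"
  using C11_ball_lipschitz[of u 0 w] C11_ball_pos by (simp add: C11_ball_deriv_0)

lemma C11_ball_quadratic: "u \<in> ball 0 \<epsilon> \<Longrightarrow> \<bar>G u\<bar> \<le> L * norm u ^ 2"
  using C11_ball_taylor[of 0 u] C11_ball_pos jet by (simp add: C11_ball_deriv_0 zero_1_jet_def)

text \<open>The derivative vanishes at 0, so the Lipschitz constant on a ball shrinks with its
  radius. This smallness lets two center manifolds be compared and y + p be solved for y.\<close>

lemma C11_ball_mvt:
  assumes \<rho>: "\<rho> \<le> \<epsilon>" "u \<in> ball 0 \<rho>" "v \<in> ball 0 \<rho>"
  shows "\<bar>G v - G u\<bar> \<le> L * \<rho> * norm (v - u)"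
proof -
  have "norm (G v - G u) \<le> L * \<rho> * norm (v - u)"
  proof (rule differentiable_bound[of "ball 0 \<rho>"])
    fix x :: 'a assume x: "x \<in> ball 0 \<rho>"
    show "(G has_derivative D x) (at x within ball 0 \<rho>)"
      using C11_ball_has_derivative x \<rho> by (auto intro: has_derivative_at_withinI)
    have "\<bar>D x w\<bar> \<le> L * \<rho> * norm w" for w :: 'a
      by (rule order_trans[OF C11_ball_deriv_le])
        (use x \<rho> C11_ball_pos in \<open>auto intro!: mult_right_mono mult_left_mono\<close>)
    moreover have "0 < \<rho>" using x by (auto intro: le_less_trans[OF norm_ge_zero])
    ultimately show "onorm (D x) \<le> L * \<rho>" using C11_ball_pos by (intro onorm_bound) auto
  qed (use \<rho> in auto)
  then show ?thesis by simp
qed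

end

end

section \<open>Functions of class C^k and restriction to a graph\<close>

lemma Ck_on_imp_continuous_on: "Ck_on k g V \<Longrightarrow> continuous_on V g"
proof (cases k)
  case (Suc l)
  moreover assume "Ck_on k g V"
  ultimately show ?thesis
    using has_derivative_continuous by (fastforce intro: continuous_at_imp_continuous_on)
qed auto

lemma abs_linear2_le:
  fixes w :: "real \<times> real"
  assumes "\<bar>a\<bar> \<le> A" "\<bar>b\<bar> \<le> B"
  shows "\<bar>a * fst w + b * snd w\<bar> \<le> (A + B) * norm w"
  using abs_linear3_le[of a A b B 0 0 "(fst w, snd w, 0)"] assms by (cases w) (simp add: norm_Pair)

lemma Ck_on_Suc_lipschitz:
  assumes "Ck_on (Suc k) g V" "open V" "0 \<in> V"
  obtains \<epsilon> L where "\<epsilon> > 0" "ball 0 \<epsilon> \<subseteq> V"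
    "\<And>u v. u \<in> ball 0 \<epsilon> \<Longrightarrow> v \<in> ball 0 \<epsilon> \<Longrightarrow> \<bar>g u - g v\<bar> \<le> L * norm (u - v)"
proof -
  from assms(1) obtain gx gy where g: "\<And>u. u \<in> V \<Longrightarrow> (g has_derivative (\<lambda>(v, w). gx u * v + gy u * w)) (at u)"
    and gxy: "Ck_on k gx V" "Ck_on k gy V" by auto
  from assms obtain \<epsilon> where \<epsilon>: "\<epsilon> > 0" "cball 0 \<epsilon> \<subseteq> V" using open_contains_cball by blast
  have bdd: "\<exists>B. \<forall>u\<in>cball 0 \<epsilon>. \<bar>f u\<bar> \<le> B" if "Ck_on k f V" for f
  proof -
    have "compact (f ` cball 0 \<epsilon>)"
      using continuous_on_subset[OF Ck_on_imp_continuous_on[OF that] \<epsilon>(2)]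
      by (intro compact_continuous_image) auto
    then have "bounded (f ` cball 0 \<epsilon>)" by (rule compact_imp_bounded)
    then show ?thesis by (auto simp: bounded_iff)
  qed
  obtain A B where A: "\<And>u. u \<in> cball 0 \<epsilon> \<Longrightarrow> \<bar>gx u\<bar> \<le> A" and B: "\<And>u. u \<in> cball 0 \<epsilon> \<Longrightarrow> \<bar>gy u\<bar> \<le> B"
    using bdd[OF gxy(1)] bdd[OF gxy(2)] by blast
  have "norm (g u - g v) \<le> (A + B) * norm (u - v)" if "u \<in> ball 0 \<epsilon>" "v \<in> ball 0 \<epsilon>" for u v
  proof (rule differentiable_bound[OF _ _ _ that])
    fix x :: "real \<times> real" assume x: "x \<in> ball 0 \<epsilon>"
    then have "x \<in> V" using \<epsilon>(2) ball_subset_cball by blast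
    then show "(g has_derivative (\<lambda>(v, w). gx x * v + gy x * w)) (at x within ball 0 \<epsilon>)"
      by (rule has_derivative_at_withinI[OF g])
    show "onorm (\<lambda>(v, w). gx x * v + gy x * w) \<le> A + B"
      using x by (intro onorm_le) (auto simp: case_prod_unfold intro!: abs_linear2_le A B)
  qed auto
  moreover have "ball 0 \<epsilon> \<subseteq> V" using \<epsilon> ball_subset_cball by blast
  ultimately show ?thesis using \<epsilon> by (intro that[of \<epsilon> "A + B"]) auto
qed

lemma C2_imp_C11:
  assumes "Ck_on (Suc (Suc k)) h V" "open V" "0 \<in> V"
  shows "\<exists>D. C11_near_0 h D"
proof -
  from assms(1) obtain hx hy where h: "\<And>u. u \<in> V \<Longrightarrow> (h has_derivative (\<lambda>(v, w). hx u * v + hy u * w)) (at u)"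
    and hxy: "Ck_on (Suc k) hx V" "Ck_on (Suc k) hy V" by auto
  obtain \<epsilon>1 A where A: "\<epsilon>1 > 0" "ball 0 \<epsilon>1 \<subseteq> V"
    "\<And>u v. u \<in> ball 0 \<epsilon>1 \<Longrightarrow> v \<in> ball 0 \<epsilon>1 \<Longrightarrow> \<bar>hx u - hx v\<bar> \<le> A * norm (u - v)"
    using Ck_on_Suc_lipschitz[OF hxy(1) assms(2,3)] by metis
  obtain \<epsilon>2 B where B: "\<epsilon>2 > 0" "ball 0 \<epsilon>2 \<subseteq> V"
    "\<And>u v. u \<in> ball 0 \<epsilon>2 \<Longrightarrow> v \<in> ball 0 \<epsilon>2 \<Longrightarrow> \<bar>hy u - hy v\<bar> \<le> B * norm (u - v)"
    using Ck_on_Suc_lipschitz[OF hxy(2) assms(2,3)] by metis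
  define D where "D u w = hx u * fst w + hy u * snd w" for u w :: "real \<times> real"
  have "(h has_derivative D u) (at u) \<and>
     (\<forall>v\<in>ball 0 (min \<epsilon>1 \<epsilon>2). \<forall>w. \<bar>D u w - D v w\<bar> \<le> (A + B) * norm (u - v) * norm w)"
    if u: "u \<in> ball 0 (min \<epsilon>1 \<epsilon>2)" for u
  proof (intro conjI ballI allI)
    show "(h has_derivative D u) (at u)"
      using h[of u] u A by (auto simp: D_def[abs_def] case_prod_unfold)
    fix v w :: "real \<times> real" assume v: "v \<in> ball 0 (min \<epsilon>1 \<epsilon>2)"
    have "D u w - D v w = (hx u - hx v) * fst w + (hy u - hy v) * snd w"
      by (simp add: D_def algebra_simps)
    also have "\<bar>\<dots>\<bar> \<le> (A * norm (u - v) + B * norm (u - v)) * norm w"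
      using u v by (intro abs_linear2_le A B) auto
    finally show "\<bar>D u w - D v w\<bar> \<le> (A + B) * norm (u - v) * norm w" by (simp add: algebra_simps)
  qed
  then have "C11_near_0 h D" unfolding C11_near_0_def using A(1) B(1)
    by (intro exI[of _ "min \<epsilon>1 \<epsilon>2"] exI[of _ "A + B"] conjI) auto
  then show ?thesis by blast
qed

lemma norm_triple_le: "norm (fst u, snd u, z) \<le> norm u + \<bar>z\<bar>" for u :: "real \<times> real" and z :: real
proof -
  have "(fst u, snd u, z) = (fst u, snd u, 0) + (0, 0, z)" by simp
  then have "norm (fst u, snd u, z) \<le> norm (fst u, snd u, 0::real) + norm (0::real, 0::real, z)"
    by (metis norm_triangle_ineq)
  then show ?thesis by (cases u) (simp add: norm_Pair)
qed

lemma restrict_to_eq: "restrict_to h G u = G (fst u, snd u, h u)"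
  by (simp add: restrict_to_def case_prod_unfold)

lemma has_derivative_restrict_to:
  assumes "(h has_derivative Dh) (at u)" "(G has_derivative D) (at (fst u, snd u, h u))"
  shows "(restrict_to h G has_derivative (\<lambda>w. D (fst w, snd w, Dh w))) (at u)"
proof -
  have "((\<lambda>u. (fst u, snd u, h u)) has_derivative (\<lambda>w. (fst w, snd w, Dh w))) (at u)"
    using assms(1) by (auto intro!: derivative_eq_intros)
  from diff_chain_at[OF this assms(2)] show ?thesis
    by (simp add: o_def restrict_to_eq[abs_def])
qed

lemma zero_1_jet_restrict_to:
  assumes "zero_1_jet h" "zero_1_jet G"
  shows "zero_1_jet (restrict_to h G)"
  using has_derivative_restrict_to[of h _ 0 G "\<lambda>_. 0"] assms
  by (auto simp: zero_1_jet_def restrict_to_eq zero_prod_def)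

text \<open>By the chain rule the derivative depends on the point twice, through the base point on
  the graph and through the tangent vector (w, Dh w). Each dependence is Lipschitz, and the two are
  estimated separately.\<close>

lemma C11_restrict_to:
  assumes h: "C11_near_0 h Dh" "zero_1_jet h" and G: "C11_near_0 G D" "zero_1_jet G"
  shows "C11_near_0 (restrict_to h G) (\<lambda>u w. D (fst u, snd u, h u) (fst w, snd w, Dh u w))"
proof -
  obtain \<epsilon>1 L1 where h1: "C11_ball \<epsilon>1 L1 h Dh" using h(1) by (rule C11_near_0_imp_ball)
  obtain \<epsilon>2 L2 where G1: "C11_ball \<epsilon>2 L2 G D" using G(1) by (rule C11_near_0_imp_ball)
  note 1 = C11_ball_pos[OF h1] C11_ball_has_derivative[OF h1] C11_ball_lipschitz[OF h1]
    C11_ball_deriv_le[OF h1 h(2)] C11_ball_quadratic[OF h1 h(2)] C11_ball_mvt[OF h1 h(2)]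
  note 2 = C11_ball_pos[OF G1] C11_ball_has_derivative[OF G1] C11_ball_lipschitz[OF G1]
    C11_ball_deriv_le[OF G1 G(2)]
  \<comment> \<open>The bound 1/L1 makes \<open>h\<close> 1-Lipschitz on the ball, hence the graph
    map \<iota> 2-Lipschitz, which explains \<epsilon>2/2; the bound 1 keeps the norm of \<iota>
    below 2.\<close>
  define \<epsilon> where "\<epsilon> = min (min \<epsilon>1 (\<epsilon>2 / 2)) (min 1 (1 / L1))"
  have \<epsilon>: "\<epsilon> > 0" "\<epsilon> \<le> \<epsilon>1" "\<epsilon> \<le> \<epsilon>2 / 2" "\<epsilon> \<le> 1" "L1 * \<epsilon> \<le> 1"
  proof -
    have "L1 * \<epsilon> \<le> L1 * (1 / L1)" using 1(2) by (intro mult_left_mono) (auto simp: \<epsilon>_def)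
    then show "L1 * \<epsilon> \<le> 1" using 1(2) by simp
  qed (use 1(1,2) 2(1) in \<open>auto simp: \<epsilon>_def\<close>)
  define \<iota> where "\<iota> u = (fst u, snd u, h u)" for u :: "real \<times> real"
  have lip\<iota>: "norm (\<iota> u - \<iota> v) \<le> 2 * norm (u - v)" if "u \<in> ball 0 \<epsilon>" "v \<in> ball 0 \<epsilon>" for u v :: "real \<times> real"
  proof -
    have "\<bar>h u - h v\<bar> \<le> (L1 * \<epsilon>) * norm (u - v)" using 1(7)[OF \<epsilon>(2) that(2,1)] .
    also have "\<dots> \<le> 1 * norm (u - v)" using \<epsilon> by (intro mult_right_mono) auto
    finally show ?thesis using norm_triple_le[of "u - v" "h u - h v"] by (simp add: \<iota>_def)
  qed
  have h0: "\<iota> 0 = 0" using h(2) by (simp add: \<iota>_def zero_1_jet_def zero_prod_def)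
  have norm\<iota>: "norm (\<iota> u) \<le> 2 * norm u" if "u \<in> ball 0 \<epsilon>" for u :: "real \<times> real"
    using lip\<iota>[OF that, of 0] \<epsilon> by (simp add: h0)
  have \<iota>: "\<iota> u \<in> ball 0 \<epsilon>2" if "u \<in> ball 0 \<epsilon>" for u :: "real \<times> real"
    using norm\<iota>[OF that] that \<epsilon> by auto
  show ?thesis
    unfolding C11_near_0_def
  proof (intro exI conjI ballI allI)
    show "\<epsilon> > 0" by (fact \<epsilon>)
    fix u :: "real \<times> real" assume u: "u \<in> ball 0 \<epsilon>"
    show "(restrict_to h G has_derivative (\<lambda>w. D (fst u, snd u, h u) (fst w, snd w, Dh u w))) (at u)"
      using 2(3)[OF \<iota>[OF u]] u \<epsilon> by (intro has_derivative_restrict_to 1(3)) (auto simp: \<iota>_def)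
    fix v w :: "real \<times> real" assume v: "v \<in> ball 0 \<epsilon>"
    have uv1: "u \<in> ball 0 \<epsilon>1" "v \<in> ball 0 \<epsilon>1" using u v \<epsilon> by auto
    have "D (\<iota> v) (fst w, snd w, Dh u w) - D (\<iota> v) (fst w, snd w, Dh v w) = D (\<iota> v) (0, 0, Dh u w - Dh v w)"
      using linear_diff[OF has_derivative_linear[OF 2(3)[OF \<iota>[OF v]]], of "(fst w, snd w, Dh u w)" "(fst w, snd w, Dh v w)"]
      by simp
    also have "\<bar>\<dots>\<bar> \<le> L2 * norm (\<iota> v) * norm (0::real, 0::real, Dh u w - Dh v w)"
      by (rule 2(5)[OF \<iota>[OF v]])
    also have "\<dots> \<le> L2 * 2 * (L1 * norm (u - v) * norm w)"
      using norm\<iota>[OF v] v \<epsilon> 2(2) 1(4)[OF uv1, of w]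
      by (intro mult_mono mult_left_mono) (auto simp: norm_Pair)
    finally have a: "\<bar>D (\<iota> v) (fst w, snd w, Dh u w) - D (\<iota> v) (fst w, snd w, Dh v w)\<bar>
        \<le> 2 * L2 * L1 * norm (u - v) * norm w" by (simp add: mult_ac)
    have "\<bar>Dh u w\<bar> \<le> (L1 * norm u) * norm w" by (rule 1(5)[OF uv1(1)])
    also have "\<dots> \<le> 1 * norm w"
      using u \<epsilon>(5) 1(2) order_trans[OF mult_left_mono[of "norm u" \<epsilon> L1]] by (intro mult_right_mono) auto
    finally have wn: "norm (fst w, snd w, Dh u w) \<le> 2 * norm w"
      using norm_triple_le[of w "Dh u w"] by simp
    have "\<bar>D (\<iota> u) (fst w, snd w, Dh u w) - D (\<iota> v) (fst w, snd w, Dh u w)\<bar>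
        \<le> L2 * norm (\<iota> u - \<iota> v) * norm (fst w, snd w, Dh u w)"
      by (rule 2(4)[OF \<iota>[OF u] \<iota>[OF v]])
    also have "\<dots> \<le> L2 * (2 * norm (u - v)) * (2 * norm w)"
      using wn lip\<iota>[OF u v] 2(2) by (intro mult_mono mult_left_mono) auto
    finally have "\<bar>D (\<iota> u) (fst w, snd w, Dh u w) - D (\<iota> v) (fst w, snd w, Dh v w)\<bar>
        \<le> L2 * (2 * norm (u - v)) * (2 * norm w) + 2 * L2 * L1 * norm (u - v) * norm w"
      using a by linarith
    then show "\<bar>D (fst u, snd u, h u) (fst w, snd w, Dh u w) - D (fst v, snd v, h v) (fst w, snd w, Dh v w)\<bar>
        \<le> (4 * L2 + 2 * L2 * L1) * norm (u - v) * norm w"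
      by (simp add: \<iota>_def algebra_simps)
  qed
qed

section \<open>Flatness of solutions of the transport equation\<close>

text \<open>The third component of an orbit inside the graph is \<open>h\<close> of the first two.
  Its derivative at time 0 is computed by the chain rule and read off from the field.
  \<open>Dh\<close> is arbitrary, so that any available derivative of \<open>h\<close> may be
  inserted.\<close>

lemma center_manifold_invariance:
  assumes cm: "center_manifold (field3 lam P Q R) U r h V" and "u \<in> V" and Dh: "(h has_derivative Dh) (at u)"
  shows "Dh (planar_field (restrict_to h P) (restrict_to h Q) u) = - lam * h u + restrict_to h R u"
proof -
  obtain x y where u: "u = (x, y)" by (cases u)
  have "(x, y, h (x, y)) \<in> graph_over h V" using \<open>u \<in> V\<close> u by (auto simp: graph_over_def)
  with cm obtain \<epsilon> \<gamma> where \<epsilon>: "\<epsilon> > 0"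
    and sol: "solution_in (field3 lam P Q R) (graph_over h V) {-\<epsilon><..<\<epsilon>} \<gamma>" and \<gamma>0: "\<gamma> 0 = (x, y, h (x, y))"
    unfolding center_manifold_def by meson
  have D\<gamma>: "(\<gamma> has_vector_derivative (y + P (x, y, h (x, y)), Q (x, y, h (x, y)),
      - lam * h (x, y) + R (x, y, h (x, y)))) (at 0)"
  proof -
    have "(\<gamma> has_vector_derivative field3 lam P Q R (\<gamma> 0)) (at 0 within {-\<epsilon><..<\<epsilon>})"
      using sol \<epsilon> unfolding solution_in_def by auto
    then show ?thesis using \<epsilon> at_within_open[of 0 "{-\<epsilon><..<\<epsilon>}"] by (simp add: field3_def \<gamma>0)
  qed
  define c where "c t = (fst (\<gamma> t), fst (snd (\<gamma> t)))" for t
  have D2: "((\<lambda>t. snd (\<gamma> t)) has_vector_derivative (Q (x, y, h (x, y)), - lam * h (x, y) + R (x, y, h (x, y)))) (at 0)"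
    using bounded_linear.has_vector_derivative[OF bounded_linear_snd D\<gamma>] by simp
  have "(c has_vector_derivative (y + P (x, y, h (x, y)), Q (x, y, h (x, y)))) (at 0)"
    unfolding c_def
    using bounded_linear.has_vector_derivative[OF bounded_linear_fst D\<gamma>]
      bounded_linear.has_vector_derivative[OF bounded_linear_fst D2]
    by (intro has_vector_derivative_Pair) auto
  moreover have "(h has_derivative Dh) (at (c 0))" using Dh by (simp add: c_def \<gamma>0 u)
  ultimately have "((h \<circ> c) has_vector_derivative Dh (y + P (x, y, h (x, y)), Q (x, y, h (x, y)))) (at 0)"
    using vector_derivative_diff_chain_within[of c _ 0 UNIV h Dh]
      has_derivative_at_withinI[of h Dh "c 0" "range c"] by simp
  then have "((\<lambda>t. snd (snd (\<gamma> t))) has_vector_derivative Dh (y + P (x, y, h (x, y)), Q (x, y, h (x, y)))) (at 0)"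
  proof (rule has_vector_derivative_transform_within_open[of _ _ _ "{-\<epsilon><..<\<epsilon>}"])
    fix t assume "t \<in> {-\<epsilon><..<\<epsilon>}"
    then have "\<gamma> t \<in> graph_over h V" using sol by (auto simp: solution_in_def)
    then show "(h \<circ> c) t = snd (snd (\<gamma> t))" by (auto simp: graph_over_def c_def)
  qed (use \<epsilon> in auto)
  from vector_derivative_unique_at[OF this bounded_linear.has_vector_derivative[OF bounded_linear_snd D2]]
  show ?thesis by (simp add: u planar_field_def restrict_to_def)
qed

text \<open>Testing the field at an interior maximum replaces integration along orbits, so both
  signs of \<open>lam\<close> are treated at once and nothing need be known about how long orbits
  stay near the origin.\<close>

lemma flat_of_transport:
  fixes d p q :: "real \<times> real \<Rightarrow> real" and lam :: real and k :: nat
  assumes lam: "lam \<noteq> 0" and "d 0 = 0"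
    and Dd: "\<forall>\<^sub>F u in nhds 0. (d has_derivative Dd u) (at u)"
    and p: "\<And>\<eta>. \<eta> > 0 \<Longrightarrow> \<forall>\<^sub>F u in nhds 0. \<bar>p u\<bar> \<le> \<eta> * norm u"
    and q: "\<And>\<eta>. \<eta> > 0 \<Longrightarrow> \<forall>\<^sub>F u in nhds 0. \<bar>q u\<bar> \<le> \<eta> * norm u"
    and tr: "\<And>\<eta>. \<eta> > 0 \<Longrightarrow> \<forall>\<^sub>F u in nhds 0. \<bar>Dd u (planar_field p q u) + lam * d u\<bar> \<le> \<eta> * \<bar>d u\<bar>"
  obtains C where "C \<ge> 0" "\<forall>\<^sub>F u in nhds 0. \<bar>d u\<bar> \<le> C * norm u ^ k"
proof -
  \<comment> \<open>With \<eta> = |lam|/2 in \<open>tr\<close>, the relative rate of d^2 is at least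
    |lam| in absolute value. \<open>K\<close> makes the rate of \<sigma>^k, at most 2k/K, smaller
    than that.\<close>
  define K where "K = 2 * real k / \<bar>lam\<bar> + 1"
  have K1: "K \<ge> 1" by (simp add: K_def)
  have Kk: "real k * (2 / K) < \<bar>lam\<bar>"
  proof -
    have "\<bar>lam\<bar> * K = 2 * real k + \<bar>lam\<bar>" using lam by (simp add: K_def distrib_left)
    then show ?thesis using K1 lam by (simp add: divide_less_eq mult.commute)
  qed
  define \<sigma> where "\<sigma> u = fst u ^ 2 + (K * snd u) ^ 2" for u :: "real \<times> real"
  define D\<sigma> where "D\<sigma> u w = 2 * fst u * fst w + 2 * K ^ 2 * snd u * snd w" for u w :: "real \<times> real"
  have D\<sigma>: "(\<sigma> has_derivative D\<sigma> u) (at u)" for u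
    unfolding \<sigma>_def[abs_def] D\<sigma>_def[abs_def]
    by (auto intro!: derivative_eq_intros simp: power2_eq_square algebra_simps)
  have \<sigma>_nonneg: "\<sigma> u \<ge> 0" for u by (simp add: \<sigma>_def)
  have norm_le: "norm u ^ 2 \<le> \<sigma> u" for u
  proof -
    have "snd u ^ 2 \<le> (K * snd u) ^ 2"
      using K1 by (simp add: power_mult_distrib mult_le_cancel_right1)
    then show ?thesis by (cases u) (simp add: \<sigma>_def norm_Pair)
  qed
  have le_norm: "\<sigma> u \<le> (K * norm u) ^ 2" for u
  proof -
    have "fst u ^ 2 \<le> (K * fst u) ^ 2"
      using K1 by (simp add: power_mult_distrib mult_le_cancel_right1)
    then show ?thesis by (cases u) (simp add: \<sigma>_def norm_Pair power_mult_distrib algebra_simps)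
  qed
  \<comment> \<open>The linear part y of x' contributes at most \<sigma>/K to the derivative of
    \<sigma>. This \<eta> limits the joint contribution of \<open>p\<close> and \<open>q\<close> to
    another \<sigma>/K.\<close>
  define \<eta> where "\<eta> = 1 / (2 * K * (1 + K))"
  have "\<eta> > 0" using K1 by (simp add: \<eta>_def)
  have "\<forall>\<^sub>F u in nhds 0. (d has_derivative Dd u) (at u) \<and> \<bar>p u\<bar> \<le> \<eta> * norm u \<and> \<bar>q u\<bar> \<le> \<eta> * norm u \<and>
      \<bar>Dd u (planar_field p q u) + lam * d u\<bar> \<le> (\<bar>lam\<bar> / 2) * \<bar>d u\<bar>"
    using Dd p[OF \<open>\<eta> > 0\<close>] q[OF \<open>\<eta> > 0\<close>] tr[of "\<bar>lam\<bar> / 2"] lam by (intro eventually_conj) auto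
  then obtain \<delta>' where "\<delta>' > 0" and \<delta>': "\<And>u. dist u 0 < \<delta>' \<Longrightarrow> (d has_derivative Dd u) (at u) \<and>
      \<bar>p u\<bar> \<le> \<eta> * norm u \<and> \<bar>q u\<bar> \<le> \<eta> * norm u \<and>
      \<bar>Dd u (planar_field p q u) + lam * d u\<bar> \<le> (\<bar>lam\<bar> / 2) * \<bar>d u\<bar>"
    unfolding eventually_nhds_metric by blast
  define \<delta> where "\<delta> = \<delta>' / 2"
  have \<delta>: "\<delta> > 0" using \<open>\<delta>' > 0\<close> by (simp add: \<delta>_def)
  \<comment> \<open>On a sublevel set of \<sigma> itself, a maximum that is not interior lies where
    \<sigma> has the known value \<delta>^2.\<close>
  define B where "B = {u. \<sigma> u \<le> \<delta> ^ 2}"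
  have B_cball: "B \<subseteq> cball 0 \<delta>"
  proof
    fix u assume "u \<in> B"
    then have "norm u ^ 2 \<le> \<delta> ^ 2" using norm_le[of u] by (simp add: B_def)
    then have "norm u \<le> \<delta>" by (rule power2_le_imp_le) (use \<delta> in simp)
    then show "u \<in> cball 0 \<delta>" by simp
  qed
  have der: "(d has_derivative Dd u) (at u)" and p': "\<bar>p u\<bar> \<le> \<eta> * norm u" and q': "\<bar>q u\<bar> \<le> \<eta> * norm u"
    and tr': "\<bar>Dd u (planar_field p q u) + lam * d u\<bar> \<le> (\<bar>lam\<bar> / 2) * \<bar>d u\<bar>" if "u \<in> B" for u
    using \<delta>'[of u] that B_cball \<delta> by (auto simp: \<delta>_def)
  have \<sigma>_cont: "continuous_on A \<sigma>" for A
    unfolding \<sigma>_def by (intro continuous_intros)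
  have d_cont: "continuous_on B d"
    by (intro continuous_at_imp_continuous_on ballI has_derivative_continuous[OF der])
  have "closed B" unfolding B_def using \<sigma>_cont by (intro closed_Collect_le) auto
  moreover have "bounded B" using B_cball bounded_cball bounded_subset by blast
  ultimately have cB: "compact B" by (simp add: compact_eq_bounded_closed)
  have "0 \<in> B" by (simp add: B_def \<sigma>_def)
  have "open {u. \<sigma> u < \<delta> ^ 2}" using \<sigma>_cont by (intro open_Collect_less) auto
  have flow: "\<bar>D\<sigma> u (planar_field p q u)\<bar> \<le> 2 / K * \<sigma> u" if "u \<in> B" for u
  proof -
    obtain x y where u: "u = (x, y)" by (cases u)
    define s where "s = sqrt (\<sigma> u)"
    have s: "s \<ge> 0" "s * s = \<sigma> u" using \<sigma>_nonneg by (auto simp: s_def)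
    have nu: "norm u \<le> s" using norm_le[of u] unfolding s_def by (simp add: real_le_rsqrt)
    have x: "\<bar>x\<bar> \<le> s" and y: "K * \<bar>y\<bar> \<le> s"
      using K1 by (auto simp: s_def \<sigma>_def u intro!: real_le_rsqrt simp: power_mult_distrib)
    have xy: "2 * \<bar>x\<bar> * (K * \<bar>y\<bar>) \<le> \<sigma> u"
      using sum_squares_bound[of "\<bar>x\<bar>" "K * \<bar>y\<bar>"] by (simp add: \<sigma>_def u power_mult_distrib)
    have xp: "\<bar>x\<bar> * \<bar>p u\<bar> \<le> s * (\<eta> * s)"
      using x p'[OF that] nu s(1) \<open>\<eta> > 0\<close> by (intro mult_mono) (auto intro: order_trans[OF _ mult_left_mono])
    have yq: "(K * \<bar>y\<bar>) * \<bar>q u\<bar> \<le> s * (\<eta> * s)"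
      using y q'[OF that] nu s(1) \<open>\<eta> > 0\<close> by (intro mult_mono) (auto intro: order_trans[OF _ mult_left_mono])
    have "\<bar>D\<sigma> u (planar_field p q u)\<bar> = \<bar>2 * x * y + 2 * x * p u + 2 * K * K * y * q u\<bar>"
      by (simp add: D\<sigma>_def planar_field_def u power2_eq_square algebra_simps)
    also have "\<dots> \<le> \<bar>2 * x * y\<bar> + \<bar>2 * x * p u\<bar> + \<bar>2 * K * K * y * q u\<bar>" by linarith
    also have "\<dots> = (2 * \<bar>x\<bar> * (K * \<bar>y\<bar>)) / K + 2 * (\<bar>x\<bar> * \<bar>p u\<bar>) + 2 * K * ((K * \<bar>y\<bar>) * \<bar>q u\<bar>)"
      using K1 by (simp add: abs_mult)
    also have "\<dots> \<le> \<sigma> u / K + 2 * (s * (\<eta> * s)) + 2 * K * (s * (\<eta> * s))"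
      using K1 xy xp yq by (intro add_mono divide_right_mono mult_left_mono) auto
    also have "\<dots> = \<sigma> u / K + 2 * (1 + K) * \<eta> * \<sigma> u" by (simp add: s(2)[symmetric] algebra_simps)
    also have "2 * (1 + K) * \<eta> = 1 / K"
    proof -
      have "z * (1 / (z * K)) = 1 / K" if "z \<noteq> 0" for z using that by simp
      moreover have "2 * (1 + K) > 0" using K1 by (intro mult_pos_pos) auto
      then have "2 * (1 + K) \<noteq> 0" by (rule less_imp_neq[THEN not_sym])
      moreover have "2 * K * (1 + K) = 2 * (1 + K) * K" by (simp only: mult_ac)
      ultimately show ?thesis unfolding \<eta>_def by metis
    qed
    finally show ?thesis by (simp add: field_simps)
  qed
  obtain uM where "uM \<in> B" and M: "\<And>u. u \<in> B \<Longrightarrow> d u ^ 2 \<le> d uM ^ 2"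
    using continuous_attains_sup[OF cB, of "\<lambda>u. d u ^ 2"] \<open>0 \<in> B\<close> d_cont
    by (metis continuous_on_power empty_iff)
  \<comment> \<open>This bounds the quotient where \<sigma> = \<delta>^2, for every regularization
    \<open>e\<close>; hence \<open>C\<close> survives the limit.\<close>
  define C where "C = d uM ^ 2 / (\<delta> ^ 2) ^ k"
  have C0: "C \<ge> 0" using \<delta> by (simp add: C_def)
  have reg: "d u ^ 2 \<le> C * (\<sigma> u ^ k + e)" if "e > 0" "u \<in> B" for e u
  proof -
    \<comment> \<open>Adding \<open>e\<close> keeps the quotient differentiable at the origin, where
      \<sigma> vanishes.\<close>
    define S where "S u = \<sigma> u ^ k + e" for u
    have S: "S u > 0" for u using \<sigma>_nonneg[of u] \<open>e > 0\<close> by (simp add: S_def add_nonneg_pos)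
    define \<phi> where "\<phi> u = d u ^ 2 / S u" for u
    have "continuous_on B \<phi>"
      unfolding \<phi>_def S_def using d_cont \<sigma>_cont S by (intro continuous_intros) (auto simp: S_def less_imp_neq[THEN not_sym])
    then obtain v where v: "v \<in> B" and vmax: "\<And>u. u \<in> B \<Longrightarrow> \<phi> u \<le> \<phi> v"
      using continuous_attains_sup[OF cB, of \<phi>] \<open>0 \<in> B\<close> by blast
    have "\<phi> v \<le> C"
    proof (cases "\<sigma> v < \<delta> ^ 2")
      case False
      then have "\<sigma> v = \<delta> ^ 2" using v by (simp add: B_def)
      then have "\<phi> v \<le> d uM ^ 2 / S v" unfolding \<phi>_def using M[OF v] S[of v] by (intro divide_right_mono) auto
      also have "\<dots> \<le> C" unfolding C_def S_def \<open>\<sigma> v = \<delta> ^ 2\<close>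
        using \<delta> \<open>e > 0\<close> by (intro divide_left_mono mult_pos_pos add_pos_pos) auto
      finally show ?thesis .
    next
      case True
      define D\<phi> where "D\<phi> w = (2 * d v * Dd v w * S v - d v ^ 2 * (real k * \<sigma> v ^ (k - 1) * D\<sigma> v w)) / (S v * S v)" for w
      have "(\<phi> has_derivative D\<phi>) (at v)"
        unfolding \<phi>_def D\<phi>_def S_def using S[of v]
        by (auto intro!: derivative_eq_intros der[OF v] D\<sigma> simp: S_def field_simps power2_eq_square)
      then have "D\<phi> = (\<lambda>_. 0)"
        by (rule differential_zero_maxmin[of v "{u. \<sigma> u < \<delta> ^ 2}", rotated 2])
          (use True \<open>open _\<close> vmax in \<open>auto simp: B_def\<close>)
      then have "D\<phi> (planar_field p q v) = 0" by simp
      then have eq: "2 * d v * Dd v (planar_field p q v) * S v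
          = d v ^ 2 * (real k * \<sigma> v ^ (k - 1) * D\<sigma> v (planar_field p q v))"
        using S[of v] by (simp add: D\<phi>_def)
      \<comment> \<open>At an interior critical point with d v nonzero, d^2 and S would have the
        same relative rate along the field; the first is at least |lam|, the second at most 2k/K in
        absolute value.\<close>
      have "d v = 0"
      proof (rule ccontr)
        assume dv: "d v \<noteq> 0"
        have "\<bar>lam\<bar> / 2 * \<bar>d v\<bar> \<le> \<bar>Dd v (planar_field p q v)\<bar>"
          using tr'[OF v] abs_triangle_ineq2[of "lam * d v" "- Dd v (planar_field p q v)"]
          by (simp add: abs_mult field_simps)
        then have "2 * \<bar>d v\<bar> * (\<bar>lam\<bar> / 2 * \<bar>d v\<bar>) * S v \<le> 2 * \<bar>d v\<bar> * \<bar>Dd v (planar_field p q v)\<bar> * S v"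
          using S[of v] by (intro mult_right_mono mult_left_mono) auto
        also have "\<dots> = \<bar>2 * d v * Dd v (planar_field p q v) * S v\<bar>" using S[of v] by (simp add: abs_mult)
        also have "\<dots> = d v ^ 2 * (real k * \<sigma> v ^ (k - 1) * \<bar>D\<sigma> v (planar_field p q v)\<bar>)"
          unfolding eq using \<sigma>_nonneg[of v] by (simp add: abs_mult)
        also have "\<dots> \<le> d v ^ 2 * (real k * \<sigma> v ^ (k - 1) * (2 / K * \<sigma> v))"
          using flow[OF v] \<sigma>_nonneg[of v] by (intro mult_left_mono) auto
        also have "real k * \<sigma> v ^ (k - 1) * (2 / K * \<sigma> v) = real k * (2 / K) * \<sigma> v ^ k"
          by (cases k) (auto simp: mult_ac)
        also have "d v ^ 2 * (real k * (2 / K) * \<sigma> v ^ k) \<le> d v ^ 2 * (real k * (2 / K) * S v)"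
          using K1 \<open>e > 0\<close> by (intro mult_left_mono) (auto simp: S_def)
        finally have "d v ^ 2 * (\<bar>lam\<bar> * S v) \<le> d v ^ 2 * (real k * (2 / K) * S v)"
          by (simp add: power2_eq_square mult_ac)
        then have "\<bar>lam\<bar> * S v \<le> real k * (2 / K) * S v"
          by (rule mult_left_le_imp_le) (use dv in simp)
        with mult_strict_right_mono[OF Kk S[of v]] show False by linarith
      qed
      then show ?thesis using C0 by (simp add: \<phi>_def)
    qed
    then have "\<phi> u \<le> C" using vmax[OF that(2)] by simp
    then show ?thesis using S[of u] by (simp add: \<phi>_def S_def field_simps)
  qed
  have lim: "d u ^ 2 \<le> C * \<sigma> u ^ k" if "u \<in> B" for u
  proof (rule field_le_epsilon)
    fix e :: real assume "e > 0"
    \<comment> \<open>The denominator C + 1 also covers C = 0.\<close>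
    have "d u ^ 2 \<le> C * (\<sigma> u ^ k + e / (C + 1))" using C0 \<open>e > 0\<close> by (intro reg that) auto
    also have "\<dots> = C * \<sigma> u ^ k + e * (C / (C + 1))" by (simp add: algebra_simps)
    also have "\<dots> \<le> C * \<sigma> u ^ k + e * 1" using C0 \<open>e > 0\<close> by (intro add_mono mult_left_mono) auto
    finally show "d u ^ 2 \<le> C * \<sigma> u ^ k + e" by simp
  qed
  have "\<bar>d u\<bar> \<le> (sqrt C * K ^ k) * norm u ^ k" if "u \<in> B" for u
  proof (rule power2_le_imp_le)
    have "d u ^ 2 \<le> C * ((K * norm u) ^ 2) ^ k"
      by (rule order_trans[OF lim[OF that]]) (intro mult_left_mono power_mono le_norm \<sigma>_nonneg C0)
    also have "\<dots> = (sqrt C * K ^ k * norm u ^ k)\<^sup>2"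
      using C0 by (simp add: power_mult_distrib power_mult[symmetric] mult.commute)
    finally show "\<bar>d u\<bar>\<^sup>2 \<le> (sqrt C * K ^ k * norm u ^ k)\<^sup>2" by simp
  qed (use C0 K1 in simp)
  moreover have "\<forall>\<^sub>F u in nhds 0. u \<in> B"
  proof -
    have "\<forall>\<^sub>F u in nhds 0. u \<in> {u. \<sigma> u < \<delta> ^ 2}"
      using \<open>open _\<close> \<delta> by (intro eventually_nhds_in_open) (auto simp: \<sigma>_def)
    then show ?thesis by eventually_elim (auto simp: B_def)
  qed
  ultimately have "\<forall>\<^sub>F u in nhds 0. \<bar>d u\<bar> \<le> (sqrt C * K ^ k) * norm u ^ k"
    by (auto elim: eventually_mono)
  then show ?thesis by (rule that[rotated]) (use C0 K1 in simp)
qed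

section \<open>A quasi-homogeneous Lyapunov function\<close>

text \<open>A weighted Young inequality. Where \<tau> is at most M X, powers of \<tau> are traded
  for powers of X; elsewhere X is at most \<tau>/M, and one factor 1/M, available since i > 0, is
  below \<eta>.\<close>

lemma mixed_monomial_le:
  fixes \<eta> :: real
  assumes "0 < \<eta>" "0 < i"
  obtains K where "K > 0" "\<And>X \<tau>. 0 \<le> X \<Longrightarrow> 0 \<le> \<tau> \<Longrightarrow> X ^ i * \<tau> ^ j \<le> \<eta> * \<tau> ^ (i + j) + K * X ^ (i + j)"
proof -
  define M where "M = 1 + 1 / \<eta>"
  have M: "M \<ge> 1" "1 / M \<le> \<eta>" using assms by (auto simp: M_def field_simps)
  have "X ^ i * \<tau> ^ j \<le> \<eta> * \<tau> ^ (i + j) + M ^ j * X ^ (i + j)" if "0 \<le> X" "0 \<le> \<tau>" for X \<tau>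
  proof (cases "\<tau> \<le> M * X")
    case True
    then have "X ^ i * \<tau> ^ j \<le> X ^ i * (M * X) ^ j"
      using that by (intro mult_left_mono power_mono) auto
    also have "\<dots> = M ^ j * X ^ (i + j)" by (simp add: power_mult_distrib power_add)
    finally show ?thesis using that assms by (simp add: add_increasing)
  next
    case False
    then have "X \<le> \<tau> / M" using M by (simp add: field_simps)
    then have "X ^ i * \<tau> ^ j \<le> (\<tau> / M) ^ i * \<tau> ^ j"
      using that by (intro mult_right_mono power_mono) auto
    also have "\<dots> = (1 / M) ^ i * \<tau> ^ (i + j)" by (simp add: power_divide power_add)
    also have "\<dots> \<le> \<eta> * \<tau> ^ (i + j)"
    proof (intro mult_right_mono)
      have "(1 / M) ^ i \<le> (1 / M) ^ 1" using M assms by (intro power_decreasing) auto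
      then show "(1 / M) ^ i \<le> \<eta>" using M by simp
    qed (use that in simp)
    finally show ?thesis using that M by (simp add: add_increasing2)
  qed
  then show ?thesis using M by (intro that[of "M ^ j"]) auto
qed

text \<open>For odd n this is the odd function equal to y^(2-1/n) for y > 0. The root is not
  differentiable at 0, but the difference quotient of the power there is exactly
  \<open>root n h ^ (n - 1)\<close>, which tends to 0 because n > 1.\<close>

lemma DERIV_root_power:
  assumes "odd n" "1 < n"
  shows "((\<lambda>y. root n y ^ (2 * n - 1)) has_real_derivative (2 * real n - 1) / real n * root n y ^ (n - 1)) (at y)"
proof (cases "y = 0")
  case True
  have "((\<lambda>h. root n h ^ (n - 1)) \<longlongrightarrow> root n 0 ^ (n - 1)) (at 0)"
    using assms by (intro tendsto_power tendsto_real_root tendsto_ident_at)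
  moreover have z0: "root n 0 ^ (n - 1) = (0::real)" using assms by simp
  ultimately have "((\<lambda>h. root n h ^ (n - 1)) \<longlongrightarrow> 0) (at 0)" by (simp only:)
  moreover have "\<forall>\<^sub>F h in at 0. root n h ^ (n - 1) = (root n (0 + h) ^ (2 * n - 1) - root n 0 ^ (2 * n - 1)) / h"
  proof (rule eventually_at_filter[THEN iffD2], rule always_eventually, intro allI impI)
    fix h :: real assume h: "h \<noteq> 0"
    have "root n h ^ (2 * n - 1) = root n h ^ (n - 1) * root n h ^ n"
      using assms by (simp add: power_add[symmetric] mult_2)
    then have e: "root n h ^ (2 * n - 1) = root n h ^ (n - 1) * h"
      by (simp only: odd_real_root_pow[OF assms(1)])
    have z: "root n 0 ^ (2 * n - 1) = (0::real)" using assms by (simp only: real_root_zero) (intro zero_power, auto)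
    show "root n h ^ (n - 1) = (root n (0 + h) ^ (2 * n - 1) - root n 0 ^ (2 * n - 1)) / h"
      unfolding z add_0 e using h by simp
  qed
  ultimately have "((\<lambda>h. (root n (0 + h) ^ (2 * n - 1) - root n 0 ^ (2 * n - 1)) / h) \<longlongrightarrow> 0) (at 0)"
    by (rule Lim_transform_eventually)
  moreover have "(2 * real n - 1) / real n * root n 0 ^ (n - 1) = 0" by (simp only: z0 mult_zero_right)
  ultimately show ?thesis unfolding True DERIV_def by (simp only:)
next
  case False
  have r: "root n y \<noteq> 0" using False assms by simp
  have "((\<lambda>y. root n y ^ (2 * n - 1)) has_real_derivative
      real (2 * n - 1) * (inverse (real n * root n y ^ (n - Suc 0)) * root n y ^ (2 * n - 1 - Suc 0))) (at y)"
    using DERIV_odd_real_root[OF assms(1) False] by (rule DERIV_power)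
  moreover have "root n y ^ (2 * n - 1 - Suc 0) = root n y ^ (n - 1) * root n y ^ (n - Suc 0)"
    using assms by (simp add: power_add[symmetric] mult_2)
  then have "real (2 * n - 1) * (inverse (real n * root n y ^ (n - Suc 0)) * root n y ^ (2 * n - 1 - Suc 0))
      = (2 * real n - 1) / real n * root n y ^ (n - 1)"
    using r assms by (simp add: of_nat_diff field_simps)
  ultimately show ?thesis by simp
qed

text \<open>The right side is the main part of the derivative of the later Lyapunov function, up to
  its sign, at Y = t^n. Since n is odd, the exponents n-1, 2n and 3n-1 are even, so the first term
  is nonnegative and the pure powers with \<epsilon> and \<mu> are positive on the axes where it
  vanishes. The mixed terms have to be absorbed.\<close>

lemma quasi_homogeneous_estimate:
  fixes A B :: real
  assumes A: "0 < A" and B: "0 < B" and n: "odd n" "1 < n"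
  obtains \<epsilon> \<mu> c where "0 < \<epsilon>" "\<epsilon> \<le> 1 / 8" "\<epsilon> \<le> A / (8 * real n)" "0 < \<mu>" "\<mu> \<le> 1 / 8" "\<mu> \<le> A / (8 * real n)" "0 < c"
    "\<And>x t \<kappa> b. \<bar>b\<bar> = B \<Longrightarrow> 0 \<le> \<kappa> \<Longrightarrow> \<kappa> \<le> 2 \<Longrightarrow>
      c * max \<bar>x\<bar> \<bar>t\<bar> ^ (3 * n - 1) \<le>
        (B - \<epsilon> * n) * x ^ (n - 1) * t ^ (2 * n) + \<epsilon> * A * x ^ (3 * n - 1) - \<epsilon> * b * x ^ (2 * n - 1) * t ^ n
        + \<mu> * (t ^ (3 * n - 1) - \<kappa> * A * x ^ (2 * n) * t ^ (n - 1) + \<kappa> * b * x ^ n * t ^ (2 * n - 1))"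
proof -
  obtain K1 where K1: "K1 > 0" "\<And>X \<tau>. 0 \<le> X \<Longrightarrow> 0 \<le> \<tau> \<Longrightarrow>
      X ^ (2 * n) * \<tau> ^ (n - 1) \<le> 1 / (8 * A) * \<tau> ^ (2 * n + (n - 1)) + K1 * X ^ (2 * n + (n - 1))"
    using mixed_monomial_le[of "1 / (8 * A)" "2 * n" "n - 1"] A n by auto
  obtain K2 where K2: "K2 > 0" "\<And>X \<tau>. 0 \<le> X \<Longrightarrow> 0 \<le> \<tau> \<Longrightarrow>
      X ^ n * \<tau> ^ (2 * n - 1) \<le> 1 / (8 * B) * \<tau> ^ (n + (2 * n - 1)) + K2 * X ^ (n + (2 * n - 1))"
    using mixed_monomial_le[of "1 / (8 * B)" n "2 * n - 1"] B n by auto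
  have e3: "2 * n + (n - 1) = 3 * n - 1" "n + (2 * n - 1) = 3 * n - 1" using n by auto
  note K1' = K1(2)[unfolded e3] and K2' = K2(2)[unfolded e3]
  define K where "K = 2 * A * K1 + 2 * B * K2"
  have K: "K > 0" using A B K1 K2 by (simp add: K_def add_pos_pos)
  \<comment> \<open>The first two bounds serve the positivity of the Lyapunov function. The third
    leaves B - \<epsilon> n above B/2, and the fourth lets \<epsilon> A/2 pay for the square
    completed below.\<close>
  define \<epsilon> where "\<epsilon> = min (min (1 / 8) (A / (8 * real n))) (min (B / (4 * real n)) (A / B))"
  have \<epsilon>: "0 < \<epsilon>" "\<epsilon> \<le> 1 / 8" "\<epsilon> \<le> A / (8 * real n)" "\<epsilon> \<le> B / (4 * real n)" "\<epsilon> \<le> A / B"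
    using A B n unfolding \<epsilon>_def
    by (simp, (meson min.cobounded1 min.cobounded2 order_trans)+)
  have \<epsilon>n: "\<epsilon> * n \<le> B / 4" and \<epsilon>B: "\<epsilon> * B \<le> A"
    using \<epsilon>(4,5) n B by (auto simp: field_simps)
  \<comment> \<open>The loss \<mu> K in front of X^(3n-1) may use up only half of the remaining
    \<epsilon> A/2.\<close>
  define \<mu> where "\<mu> = min (min (1 / 8) (A / (8 * real n))) (\<epsilon> * A / (4 * K))"
  have \<mu>: "0 < \<mu>" "\<mu> \<le> 1 / 8" "\<mu> \<le> A / (8 * real n)" "\<mu> \<le> \<epsilon> * A / (4 * K)"
    using A n \<epsilon>(1) K unfolding \<mu>_def
    by (simp, (meson min.cobounded1 min.cobounded2 order_trans)+)
  have \<mu>K: "\<mu> * K \<le> \<epsilon> * A / 4" using \<mu>(4) K by (simp add: field_simps)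
  define c where "c = min (\<epsilon> * A / 4) (\<mu> / 2)"
  have c: "0 < c" using \<epsilon> \<mu> A by (simp add: c_def)
  show ?thesis
  proof (rule that[OF \<epsilon>(1-3) \<mu>(1-3) c])
    fix x t \<kappa> b :: real assume b: "\<bar>b\<bar> = B" and \<kappa>: "0 \<le> \<kappa>" "\<kappa> \<le> 2"
    define X where "X = \<bar>x\<bar>"
    define \<tau> where "\<tau> = \<bar>t\<bar>"
    have X: "0 \<le> X" and \<tau>: "0 \<le> \<tau>" by (auto simp: X_def \<tau>_def)
    have ev: "even (n - 1)" "even (3 * n - 1)" "even (2 * n)" using n by auto
    have evX: "x ^ (n - 1) = X ^ (n - 1)" "x ^ (3 * n - 1) = X ^ (3 * n - 1)" "x ^ (2 * n) = X ^ (2 * n)"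
      "t ^ (n - 1) = \<tau> ^ (n - 1)" "t ^ (3 * n - 1) = \<tau> ^ (3 * n - 1)" "t ^ (2 * n) = \<tau> ^ (2 * n)"
      using ev by (simp_all only: X_def \<tau>_def power_even_abs)
    define p where "p = X ^ n"
    define q where "q = \<tau> ^ n"
    define k where "k = X ^ (n - 1)"
    have k: "0 \<le> k" using X by (simp add: k_def)
    have e: "3 * n - 1 = (n - 1) + n + n" "2 * n - 1 = (n - 1) + n" "2 * n = n + n" using n by auto
    have X3: "X ^ (3 * n - 1) = k * (p * p)" unfolding e(1) by (simp add: power_add k_def p_def)
    have s1: "\<bar>x ^ (2 * n - 1) * t ^ n\<bar> = k * (p * q)"
      unfolding e(2) by (simp add: power_add k_def p_def q_def X_def \<tau>_def abs_mult power_abs)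
    have "\<epsilon> * b * x ^ (2 * n - 1) * t ^ n \<le> \<epsilon> * \<bar>b\<bar> * \<bar>x ^ (2 * n - 1) * t ^ n\<bar>"
      using \<epsilon>(1) abs_ge_self[of "b * (x ^ (2 * n - 1) * t ^ n)"]
      by (simp add: abs_mult mult.assoc mult_left_mono)
    then have low: "\<epsilon> * b * x ^ (2 * n - 1) * t ^ n \<le> k * (\<epsilon> * B * (p * q))"
      unfolding s1 b by (simp add: mult_ac)
    \<comment> \<open>This square produces the mixed term \<epsilon> B p q at the price of at most
      \<epsilon> A/2 of p^2 and B/2 of q^2.\<close>
    have "0 \<le> B / 2 * (\<epsilon> * p - q) ^ 2" using B by simp
    also have "\<dots> = \<epsilon> * (\<epsilon> * B) / 2 * (p * p) + B / 2 * (q * q) - \<epsilon> * B * (p * q)"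
      by (simp add: power2_eq_square algebra_simps)
    also have "\<dots> \<le> \<epsilon> * A / 2 * (p * p) + (B - \<epsilon> * n) * (q * q) - \<epsilon> * B * (p * q)"
      using \<epsilon>n \<epsilon>B \<epsilon>(1) B by (intro diff_right_mono add_mono mult_right_mono divide_right_mono mult_left_mono) auto
    finally have "0 \<le> k * (\<epsilon> * A / 2 * (p * p) + (B - \<epsilon> * n) * (q * q) - \<epsilon> * B * (p * q))"
      using k by simp
    then have part1: "\<epsilon> * A / 2 * X ^ (3 * n - 1) \<le> (B - \<epsilon> * n) * x ^ (n - 1) * t ^ (2 * n) + \<epsilon> * A * x ^ (3 * n - 1)
        - \<epsilon> * b * x ^ (2 * n - 1) * t ^ n"
      using low unfolding evX X3 unfolding k_def[symmetric] e(3) power_add q_def[symmetric]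
      by (simp add: algebra_simps)
    have "\<kappa> * A * x ^ (2 * n) * t ^ (n - 1) = \<kappa> * (A * (X ^ (2 * n) * \<tau> ^ (n - 1)))"
      unfolding evX by (simp add: mult_ac)
    also have "\<dots> \<le> 2 * (A * (1 / (8 * A) * \<tau> ^ (3 * n - 1) + K1 * X ^ (3 * n - 1)))"
      using \<kappa> A X \<tau> by (intro mult_mono mult_left_mono K1') auto
    also have "\<dots> = 1 / 4 * \<tau> ^ (3 * n - 1) + 2 * A * K1 * X ^ (3 * n - 1)"
      using A by (simp add: field_simps)
    finally have y1: "\<kappa> * A * x ^ (2 * n) * t ^ (n - 1) \<le> 1 / 4 * \<tau> ^ (3 * n - 1) + 2 * A * K1 * X ^ (3 * n - 1)" .
    have "- (\<kappa> * b * x ^ n * t ^ (2 * n - 1)) \<le> \<bar>\<kappa> * b * x ^ n * t ^ (2 * n - 1)\<bar>" by (rule abs_ge_minus_self)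
    also have "\<dots> = \<kappa> * (B * (X ^ n * \<tau> ^ (2 * n - 1)))"
      using \<kappa> b by (simp add: abs_mult power_abs X_def \<tau>_def)
    also have "\<dots> \<le> 2 * (B * (1 / (8 * B) * \<tau> ^ (3 * n - 1) + K2 * X ^ (3 * n - 1)))"
      using \<kappa> B X \<tau> by (intro mult_mono mult_left_mono K2') auto
    also have "\<dots> = 1 / 4 * \<tau> ^ (3 * n - 1) + 2 * B * K2 * X ^ (3 * n - 1)"
      using B by (simp add: field_simps)
    finally have "1 / 2 * \<tau> ^ (3 * n - 1) - K * X ^ (3 * n - 1) \<le>
        t ^ (3 * n - 1) - \<kappa> * A * x ^ (2 * n) * t ^ (n - 1) + \<kappa> * b * x ^ n * t ^ (2 * n - 1)"
      using y1 unfolding evX K_def by (simp add: algebra_simps)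
    then have part2: "\<mu> * (1 / 2 * \<tau> ^ (3 * n - 1) - K * X ^ (3 * n - 1)) \<le>
        \<mu> * (t ^ (3 * n - 1) - \<kappa> * A * x ^ (2 * n) * t ^ (n - 1) + \<kappa> * b * x ^ n * t ^ (2 * n - 1))"
      using \<mu>(1) by (intro mult_left_mono) auto
    have "c * max X \<tau> ^ (3 * n - 1) \<le> c * X ^ (3 * n - 1) + c * \<tau> ^ (3 * n - 1)"
      using c X \<tau> by (cases "X \<le> \<tau>") (auto simp: max_def)
    also have "\<dots> \<le> \<epsilon> * A / 4 * X ^ (3 * n - 1) + \<mu> / 2 * \<tau> ^ (3 * n - 1)"
      using X \<tau> by (intro add_mono mult_right_mono) (auto simp: c_def)
    also have "\<dots> \<le> (\<epsilon> * A / 2 - \<mu> * K) * X ^ (3 * n - 1) + \<mu> / 2 * \<tau> ^ (3 * n - 1)"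
    proof (intro add_right_mono mult_right_mono zero_le_power X)
      show "\<epsilon> * A / 4 \<le> \<epsilon> * A / 2 - \<mu> * K" using \<mu>K by linarith
    qed
    also have "\<dots> = \<epsilon> * A / 2 * X ^ (3 * n - 1) + \<mu> * (1 / 2 * \<tau> ^ (3 * n - 1) - K * X ^ (3 * n - 1))"
      by (simp add: algebra_simps)
    finally show "c * max \<bar>x\<bar> \<bar>t\<bar> ^ (3 * n - 1) \<le>
        (B - \<epsilon> * n) * x ^ (n - 1) * t ^ (2 * n) + \<epsilon> * A * x ^ (3 * n - 1) - \<epsilon> * b * x ^ (2 * n - 1) * t ^ n
        + \<mu> * (t ^ (3 * n - 1) - \<kappa> * A * x ^ (2 * n) * t ^ (n - 1) + \<kappa> * b * x ^ n * t ^ (2 * n - 1))"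
      using part1 part2 unfolding X_def \<tau>_def by linarith
  qed
qed

text \<open>The increase is stated at Y = t^n so that max |x| |t| measures the weighted distance to
  the origin. \<open>E1\<close> and \<open>E2\<close> are slots for all terms of higher weight, so
  the later arguments need only the size of their remainders.\<close>

lemma quasi_homogeneous_lyapunov:
  fixes A b C :: real
  assumes A: "0 < A" and b: "b \<noteq> 0" and n: "odd n" "1 < n" and C: "0 \<le> C"
  obtains s \<rho>0 :: real and W Wx Wy :: "real \<Rightarrow> real \<Rightarrow> real"
  where "\<And>x y. x \<noteq> 0 \<or> y \<noteq> 0 \<Longrightarrow> 0 < W x y" "s = 1 \<or> s = -1" "0 < \<rho>0" "W 0 0 = 0"
    "\<And>x y. ((\<lambda>u. W (fst u) (snd u)) has_derivative (\<lambda>w. Wx x y * fst w + Wy x y * snd w)) (at (x, y))"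
    "\<And>x t E1 E2. x \<noteq> 0 \<or> t \<noteq> 0 \<Longrightarrow> max \<bar>x\<bar> \<bar>t\<bar> < \<rho>0 \<Longrightarrow>
       \<bar>E1\<bar> \<le> C * max \<bar>x\<bar> \<bar>t\<bar> ^ (2 * n) \<Longrightarrow> \<bar>E2\<bar> \<le> C * max \<bar>x\<bar> \<bar>t\<bar> ^ (2 * n) \<Longrightarrow>
       0 < s * (Wx x (t ^ n) * (t ^ n + E1) + Wy x (t ^ n) * (b * x ^ (n - 1) * t ^ n - A * x ^ (2 * n - 1) + E2))"
proof -
  define B where "B = \<bar>b\<bar>"
  have B: "0 < B" using b by (simp add: B_def)
  obtain \<epsilon> \<mu> c where \<epsilon>: "0 < \<epsilon>" "\<epsilon> \<le> 1 / 8" "\<epsilon> \<le> A / (8 * real n)"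
    and \<mu>: "0 < \<mu>" "\<mu> \<le> 1 / 8" "\<mu> \<le> A / (8 * real n)" and c: "0 < c"
    and est: "\<And>x t \<kappa> b. \<bar>b\<bar> = B \<Longrightarrow> 0 \<le> \<kappa> \<Longrightarrow> \<kappa> \<le> 2 \<Longrightarrow>
      c * max \<bar>x\<bar> \<bar>t\<bar> ^ (3 * n - 1) \<le>
        (B - \<epsilon> * n) * x ^ (n - 1) * t ^ (2 * n) + \<epsilon> * A * x ^ (3 * n - 1) - \<epsilon> * b * x ^ (2 * n - 1) * t ^ n
        + \<mu> * (t ^ (3 * n - 1) - \<kappa> * A * x ^ (2 * n) * t ^ (n - 1) + \<kappa> * b * x ^ n * t ^ (2 * n - 1))"
    using quasi_homogeneous_estimate[OF A B n] by blast
  define s where "s = sgn b"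
  have s: "s = 1 \<or> s = -1" and sb: "b = s * B" and ss: "s * s = 1"
    using b by (auto simp: s_def B_def sgn_if)
  define \<kappa> where "\<kappa> = (2 * real n - 1) / real n"
  have \<kappa>: "0 \<le> \<kappa>" "\<kappa> \<le> 2" using n by (auto simp: \<kappa>_def field_simps)
  define g where "g y = root n y ^ (2 * n - 1)" for y
  \<comment> \<open>The energy has derivative b x^(n-1) y^2 along the main part. The factor
    \<open>s\<close>, the sign of b, gives the derivatives of both correctors the same sign;
    \<open>g y\<close> is the power y^(2-1/n).\<close>
  define W where "W x y = y ^ 2 / 2 + A / (2 * real n) * x ^ (2 * n) - s * \<epsilon> * x ^ n * y + s * \<mu> * x * g y" for x y
  define Wx where "Wx x y = A * x ^ (2 * n - 1) - s * \<epsilon> * real n * x ^ (n - 1) * y + s * \<mu> * g y" for x y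
  define Wy where "Wy x y = y - s * \<epsilon> * x ^ n + s * \<mu> * \<kappa> * x * root n y ^ (n - 1)" for x y
  \<comment> \<open>The partial derivatives of W are bounded below by (A + n + 1) \<rho>^n and 4
    \<rho>^n in absolute value, meaning from above; their factors add up to A + n + 5, and the 1
    makes \<open>M\<close> positive.\<close>
  define M where "M = C * (A + real n + 5) + 1"
  have M: "0 < M" using A C by (simp add: M_def add_nonneg_pos)
  define \<rho>0 where "\<rho>0 = min 1 (c / M)"
  have root: "root n (t ^ n) = t" for t using n by (simp add: odd_real_root_power_cancel)
  have root': "root n y ^ n = y" for y using n by (simp add: odd_real_root_pow)
  show ?thesis
  proof (rule that[of W s \<rho>0 Wx Wy, OF _ s])
    show "0 < \<rho>0" using c M by (simp add: \<rho>0_def)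
    show "W 0 0 = 0" using n by (simp add: W_def zero_power)
    fix x y :: real
    have Dg: "((\<lambda>u. g (snd u)) has_derivative (\<lambda>w. snd w * (\<kappa> * root n y ^ (n - 1)))) (at (x, y))"
    proof -
      have "(g has_real_derivative \<kappa> * root n y ^ (n - 1)) (at (snd (x, y)))"
        using DERIV_root_power[OF n, of y] unfolding g_def[abs_def] \<kappa>_def snd_conv .
      from DERIV_compose_FDERIV[OF this has_derivative_snd[OF has_derivative_ident]] show ?thesis .
    qed
    show "((\<lambda>u. W (fst u) (snd u)) has_derivative (\<lambda>w. Wx x y * fst w + Wy x y * snd w)) (at (x, y))"
    proof -
      have D1: "((\<lambda>u. snd u ^ 2 / 2 + A / (2 * real n) * fst u ^ (2 * n) - s * \<epsilon> * fst u ^ n * snd u) has_derivative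
          (\<lambda>w. (A * x ^ (2 * n - 1) - s * \<epsilon> * real n * x ^ (n - 1) * y) * fst w + (y - s * \<epsilon> * x ^ n) * snd w)) (at (x, y))"
        using n by (auto intro!: derivative_eq_intros simp: algebra_simps)
      have D2: "((\<lambda>u. s * \<mu> * fst u) has_derivative (\<lambda>w. s * \<mu> * fst w)) (at (x, y))"
        by (auto intro!: derivative_eq_intros)
      show ?thesis
        unfolding W_def
        by (rule has_derivative_eq_rhs[OF has_derivative_add[OF D1 has_derivative_mult[OF D2 Dg]]])
          (auto simp: Wx_def Wy_def fun_eq_iff algebra_simps)
    qed
  next
    fix x y :: real assume nz: "x \<noteq> 0 \<or> y \<noteq> 0"
    define t where "t = root n y"
    have y: "y = t ^ n" by (simp add: t_def root')
    define p where "p = \<bar>x\<bar> ^ n"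
    define q where "q = \<bar>t\<bar> ^ n"
    have pp: "x ^ (2 * n) = p * p" "t ^ (2 * n) = q * q"
      unfolding p_def q_def by (simp_all add: power_add[symmetric] mult_2[symmetric] power_even_abs)
    have y2: "y\<^sup>2 = q * q" by (simp only: y power_mult[symmetric] mult.commute[of n 2] pp)
    have "2 * (p * q) \<le> p * p + q * q" using sum_squares_bound[of p q] by (simp add: power2_eq_square)
    then have "\<epsilon> * (p * q) \<le> \<epsilon> * (p * p + q * q)" using \<epsilon>
      by (intro mult_left_mono) (auto simp: p_def q_def add_nonneg_nonneg intro: order_trans[rotated])
    moreover have "s * \<epsilon> * x ^ n * y \<le> \<epsilon> * (p * q)"
    proof -
      have "s * \<epsilon> * x ^ n * y \<le> \<bar>s * \<epsilon> * x ^ n * y\<bar>" by simp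
      also have "\<dots> = \<epsilon> * (p * q)" using s \<epsilon> by (auto simp: abs_mult y p_def q_def power_abs)
      finally show ?thesis .
    qed
    moreover have "- (s * \<mu> * x * g y) \<le> \<mu> * (p * p + q * q)"
    proof -
      have "- (s * \<mu> * x * g y) \<le> \<bar>s * \<mu> * x * g y\<bar>" by (rule abs_ge_minus_self)
      also have "\<dots> = \<mu> * (\<bar>x\<bar> * \<bar>t\<bar> ^ (2 * n - 1))"
        using s \<mu> by (auto simp: abs_mult y g_def root power_abs)
      also have "\<dots> \<le> \<mu> * (max \<bar>x\<bar> \<bar>t\<bar> * max \<bar>x\<bar> \<bar>t\<bar> ^ (2 * n - 1))"
        using \<mu> by (intro mult_left_mono mult_mono power_mono) auto
      also have "max \<bar>x\<bar> \<bar>t\<bar> * max \<bar>x\<bar> \<bar>t\<bar> ^ (2 * n - 1) = max \<bar>x\<bar> \<bar>t\<bar> ^ (2 * n)"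
        using n by (simp add: power_Suc[symmetric] del: power_Suc)
      also have "\<dots> \<le> x ^ (2 * n) + t ^ (2 * n)" by (auto simp: max_def power_even_abs)
      finally show ?thesis using \<mu> by (simp add: pp)
    qed
    \<comment> \<open>Each corrector costs at most \<epsilon> or \<mu> times p^2 + q^2; the bounds
      1/8 and A/(8n) on both leave half of the energy.\<close>
    ultimately have "q * q / 2 + A / (2 * real n) * (p * p) - (\<epsilon> + \<mu>) * (p * p + q * q) \<le> W x y"
      unfolding W_def pp y2 by (simp add: algebra_simps)
    moreover have "(\<epsilon> + \<mu>) * (p * p) \<le> A / (4 * real n) * (p * p)"
      using \<epsilon>(3) \<mu>(3) by (intro mult_right_mono) (auto simp: field_simps)
    moreover have "(\<epsilon> + \<mu>) * (q * q) \<le> 1 / 4 * (q * q)"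
      using \<epsilon>(2) \<mu>(2) by (intro mult_right_mono) auto
    moreover have "A / (2 * real n) * (p * p) - A / (4 * real n) * (p * p) = A / (4 * real n) * (p * p)"
      using n by (simp add: field_simps)
    ultimately have "1 / 4 * (q * q) + A / (4 * real n) * (p * p) \<le> W x y"
      by (simp add: distrib_left)
    moreover have "0 < 1 / 4 * (q * q) + A / (4 * real n) * (p * p)"
    proof (cases "x = 0")
      case True
      then have "t \<noteq> 0" using nz n y by auto
      then have "0 < q" by (simp add: q_def)
      then show ?thesis using A n by (intro add_pos_nonneg) auto
    next
      case False
      then have "0 < p" by (simp add: p_def)
      then show ?thesis using A n by (intro add_nonneg_pos mult_pos_pos) auto
    qed
    ultimately show "0 < W x y" by linarith
  next
    fix x t E1 E2 :: real
    assume nz: "x \<noteq> 0 \<or> t \<noteq> 0" and small: "max \<bar>x\<bar> \<bar>t\<bar> < \<rho>0"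
      and E: "\<bar>E1\<bar> \<le> C * max \<bar>x\<bar> \<bar>t\<bar> ^ (2 * n)" "\<bar>E2\<bar> \<le> C * max \<bar>x\<bar> \<bar>t\<bar> ^ (2 * n)"
    define \<rho> where "\<rho> = max \<bar>x\<bar> \<bar>t\<bar>"
    have \<rho>: "0 < \<rho>" "\<rho> \<le> 1" "\<rho> * M < c" "\<bar>x\<bar> \<le> \<rho>" "\<bar>t\<bar> \<le> \<rho>"
      using nz small M by (auto simp: \<rho>_def \<rho>0_def max_def pos_less_divide_eq split: if_splits)
    note E = E[folded \<rho>_def]
    have pow: "\<bar>x ^ i * t ^ j\<bar> \<le> \<rho> ^ n" if "n \<le> i + j" for i j
    proof -
      have "\<bar>x ^ i * t ^ j\<bar> \<le> \<rho> ^ i * \<rho> ^ j"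
        unfolding abs_mult power_abs using \<rho> by (intro mult_mono power_mono) auto
      also have "\<dots> \<le> \<rho> ^ n" unfolding power_add[symmetric] using \<rho> that by (intro power_decreasing) auto
      finally show ?thesis .
    qed
    \<comment> \<open>The order \<rho>^n is crude for \<open>Wx\<close>, which has weight 2n-1, but
      together with errors of size \<rho>^(2n) it gives \<rho>^(3n), one power beyond the main
      part.\<close>
    have "\<bar>Wx x (t ^ n)\<bar> \<le> A * \<bar>x ^ (2 * n - 1) * t ^ 0\<bar> + \<epsilon> * real n * \<bar>x ^ (n - 1) * t ^ n\<bar> + \<mu> * \<bar>x ^ 0 * t ^ (2 * n - 1)\<bar>"
      unfolding Wx_def g_def root
      by (rule order_trans[OF abs_triangle_ineq[THEN order_trans, OF add_right_mono[OF abs_triangle_ineq4]]])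
        (use A \<epsilon> \<mu> s in \<open>auto simp: abs_mult\<close>)
    also have "\<dots> \<le> A * \<rho> ^ n + \<epsilon> * real n * \<rho> ^ n + \<mu> * \<rho> ^ n"
      using A \<epsilon> \<mu> n by (intro add_mono mult_left_mono pow) auto
    also have "\<dots> = (A + \<epsilon> * real n + \<mu>) * \<rho> ^ n" by (simp add: algebra_simps)
    also have "\<dots> \<le> (A + real n + 1) * \<rho> ^ n"
      using \<epsilon> \<mu> \<rho> by (intro mult_right_mono add_mono mult_left_le_one_le) auto
    finally have bx: "\<bar>Wx x (t ^ n)\<bar> \<le> (A + real n + 1) * \<rho> ^ n" .
    have "\<bar>Wy x (t ^ n)\<bar> \<le> \<bar>x ^ 0 * t ^ n\<bar> + \<epsilon> * \<bar>x ^ n * t ^ 0\<bar> + \<mu> * \<kappa> * \<bar>x ^ 1 * t ^ (n - 1)\<bar>"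
      unfolding Wy_def root
      by (rule order_trans[OF abs_triangle_ineq[THEN order_trans, OF add_right_mono[OF abs_triangle_ineq4]]])
        (use \<epsilon> \<mu> \<kappa> s in \<open>auto simp: abs_mult\<close>)
    also have "\<dots> \<le> \<rho> ^ n + \<epsilon> * \<rho> ^ n + \<mu> * \<kappa> * \<rho> ^ n"
      using \<kappa> \<epsilon> \<mu> n by (intro add_mono mult_left_mono pow) auto
    also have "\<dots> = (1 + \<epsilon> + \<mu> * \<kappa>) * \<rho> ^ n" by (simp add: algebra_simps)
    also have "\<dots> \<le> (1 + 1 + 1 * 2) * \<rho> ^ n"
      using \<epsilon> \<mu> \<kappa> \<rho> by (intro mult_right_mono add_mono mult_mono) auto
    finally have bY: "\<bar>Wy x (t ^ n)\<bar> \<le> 4 * \<rho> ^ n" by simp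
    have "\<bar>Wx x (t ^ n) * E1 + Wy x (t ^ n) * E2\<bar> \<le> \<bar>Wx x (t ^ n)\<bar> * \<bar>E1\<bar> + \<bar>Wy x (t ^ n)\<bar> * \<bar>E2\<bar>"
      unfolding abs_mult[symmetric] by (rule abs_triangle_ineq)
    also have "\<dots> \<le> (A + real n + 1) * \<rho> ^ n * (C * \<rho> ^ (2 * n)) + 4 * \<rho> ^ n * (C * \<rho> ^ (2 * n))"
      using bx bY E A \<rho> by (intro add_mono mult_mono) auto
    also have "\<dots> = (M - 1) * (\<rho> ^ n * \<rho> ^ (2 * n))" by (simp add: M_def algebra_simps)
    also have "\<dots> \<le> M * (\<rho> ^ n * \<rho> ^ (2 * n))" using \<rho> by (intro mult_right_mono) auto
    also have "\<rho> ^ n * \<rho> ^ (2 * n) = \<rho> * \<rho> ^ (3 * n - 1)"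
      using n by (simp add: power_add[symmetric] power_Suc[symmetric] del: power_Suc)
    finally have err: "\<bar>Wx x (t ^ n) * E1 + Wy x (t ^ n) * E2\<bar> \<le> \<rho> * M * \<rho> ^ (3 * n - 1)" by (simp add: mult_ac)
    \<comment> \<open>Truncated differences in the exponents become sums, which leaves a polynomial
      identity.\<close>
    obtain k where k: "n = Suc k" using n by (cases n) auto
    have e: "n - 1 = k" "2 * n - 1 = Suc (k + k)" "3 * n - 1 = Suc (Suc (k + k + k))" "2 * n = Suc (Suc (k + k))"
      by (auto simp: k)
    have "s * (Wx x (t ^ n) * t ^ n + Wy x (t ^ n) * (b * x ^ (n - 1) * t ^ n - A * x ^ (2 * n - 1)))
      = (B - \<epsilon> * n) * x ^ (n - 1) * t ^ (2 * n) + \<epsilon> * A * x ^ (3 * n - 1) - \<epsilon> * b * x ^ (2 * n - 1) * t ^ n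
        + \<mu> * (t ^ (3 * n - 1) - \<kappa> * A * x ^ (2 * n) * t ^ (n - 1) + \<kappa> * b * x ^ n * t ^ (2 * n - 1))"
      unfolding Wx_def Wy_def g_def root e
      unfolding k power_Suc power_add sb
      using s by (elim disjE) (simp_all add: algebra_simps power_add)
    then have "c * \<rho> ^ (3 * n - 1) \<le>
        s * (Wx x (t ^ n) * t ^ n + Wy x (t ^ n) * (b * x ^ (n - 1) * t ^ n - A * x ^ (2 * n - 1)))"
      using est[of b \<kappa> x t] \<kappa> by (simp add: B_def \<rho>_def)
    moreover have "- \<bar>Wx x (t ^ n) * E1 + Wy x (t ^ n) * E2\<bar> \<le> s * (Wx x (t ^ n) * E1 + Wy x (t ^ n) * E2)"
      using s by auto
    moreover have "\<rho> * M * \<rho> ^ (3 * n - 1) < c * \<rho> ^ (3 * n - 1)"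
      using \<rho> by (intro mult_strict_right_mono) auto
    ultimately have "0 < s * (Wx x (t ^ n) * t ^ n + Wy x (t ^ n) * (b * x ^ (n - 1) * t ^ n - A * x ^ (2 * n - 1)))
        + s * (Wx x (t ^ n) * E1 + Wy x (t ^ n) * E2)"
      using err by linarith
    then show "0 < s * (Wx x (t ^ n) * (t ^ n + E1) + Wy x (t ^ n) * (b * x ^ (n - 1) * t ^ n - A * x ^ (2 * n - 1) + E2))"
      by (simp add: distrib_left[symmetric]) (simp add: algebra_simps)
  qed
qed

section \<open>Lyapunov functions exclude periodic orbits\<close>

text \<open>\<open>W\<close> decreases along \<open>\<gamma>(-s t)\<close>, which traps this half of the orbit in the ball; then \<open>W\<close>
  decreases over a full period, contradicting periodicity.\<close>

lemma not_center_of_lyapunov: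
  fixes X :: "real \<times> real \<Rightarrow> real \<times> real" and W :: "real \<times> real \<Rightarrow> real" and s \<delta> :: real
  assumes s: "s = 1 \<or> s = -1" and "\<delta> > 0" and W0: "W 0 = 0"
    and DW: "\<And>u. u \<in> cball 0 \<delta> \<Longrightarrow> (W has_derivative DW u) (at u)"
    and pos: "\<And>u. u \<in> cball 0 \<delta> \<Longrightarrow> u \<noteq> 0 \<Longrightarrow> W u > 0"
    and inc: "\<And>u. u \<in> cball 0 \<delta> \<Longrightarrow> u \<noteq> 0 \<Longrightarrow> s * DW u (X u) > 0"
  shows "\<not> is_center X V"
proof
  assume "is_center X V"
  then obtain N where N: "open N" "0 \<in> N" and orb: "\<And>u. u \<in> N - {0} \<Longrightarrow>
      \<exists>\<gamma>. \<exists>T>0. solution_in X (N - {0}) UNIV \<gamma> \<and> \<gamma> 0 = u \<and> (\<forall>t. \<gamma> (t + T) = \<gamma> t)"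
    unfolding is_center_def by meson
  have W_cont: "continuous_on (cball 0 \<delta>) W"
    by (intro continuous_at_imp_continuous_on ballI has_derivative_continuous[OF DW])
  have "sphere (0 :: real \<times> real) \<delta> \<noteq> {}" using \<open>\<delta> > 0\<close> by simp
  moreover have "continuous_on (sphere 0 \<delta>) W"
    using W_cont by (rule continuous_on_subset) auto
  \<comment> \<open>An orbit starting below the minimum of W on the sphere cannot reach the sphere
    while W decreases.\<close>
  ultimately obtain um where um: "um \<in> sphere 0 \<delta>" and m: "\<And>u. u \<in> sphere 0 \<delta> \<Longrightarrow> W um \<le> W u"
    using continuous_attains_inf[of "sphere 0 \<delta>" W] by auto
  have "W um > 0" using um \<open>\<delta> > 0\<close> by (intro pos) auto
  have "isCont W 0" using DW[of 0] \<open>\<delta> > 0\<close> by (intro has_derivative_continuous) auto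
  then have "(W \<longlongrightarrow> 0) (at 0)" by (simp add: isCont_def W0)
  then have "\<forall>\<^sub>F u in at 0. W u < W um" using \<open>W um > 0\<close> by (rule order_tendstoD)
  moreover have "\<forall>\<^sub>F u in at 0. u \<in> N \<inter> ball 0 \<delta>"
    using N \<open>\<delta> > 0\<close> by (intro eventually_at_in_open') auto
  moreover have "\<forall>\<^sub>F u in at (0 :: real \<times> real). u \<noteq> 0" by (simp add: eventually_at_filter)
  ultimately have "\<forall>\<^sub>F u in at (0 :: real \<times> real). W u < W um \<and> u \<in> N \<inter> ball 0 \<delta> \<and> u \<noteq> 0"
    by (intro eventually_conj)
  then obtain u where u: "W u < W um" "u \<in> N" "u \<in> ball 0 \<delta>" "u \<noteq> 0"
    using eventually_happens'[OF at_neq_bot] by blast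
  then obtain \<gamma> T where "T > 0" and sol: "solution_in X (N - {0}) UNIV \<gamma>" and \<gamma>0: "\<gamma> 0 = u"
    and per: "\<And>t. \<gamma> (t + T) = \<gamma> t" using orb[of u] by blast
  define c where "c t = \<gamma> (- s * t)" for t
  have c_nz: "c t \<noteq> 0" for t using sol by (auto simp: solution_in_def c_def)
  have c_der: "(c has_vector_derivative (- s) *\<^sub>R X (c t)) (at t)" for t
  proof -
    have "(\<gamma> has_vector_derivative X (\<gamma> (- s * t))) (at (- s * t))"
      using sol by (auto simp: solution_in_def)
    moreover have "((\<lambda>t. - s * t) has_vector_derivative - s) (at t)"
      by (auto intro!: derivative_eq_intros)
    ultimately show ?thesis
      unfolding c_def using vector_diff_chain_at[of "\<lambda>t. - s * t" "- s" t \<gamma>] by (simp add: o_def)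
  qed
  have c_cont: "continuous_on A c" for A
    by (intro continuous_at_imp_continuous_on ballI has_vector_derivative_continuous[OF c_der])
  \<comment> \<open>For s = 1 the curve runs backward in time, so the period is used at -T.\<close>
  have cT: "c T = u"
    using s per[of 0] per[of "- T"] by (auto simp: c_def \<gamma>0)
  have c0: "c 0 = u" by (simp add: c_def \<gamma>0)
  have Wc: "((\<lambda>t. W (c t)) has_real_derivative - (s * DW (c t) (X (c t)))) (at t)" if "c t \<in> cball 0 \<delta>" for t
  proof -
    have "((W \<circ> c) has_vector_derivative DW (c t) ((- s) *\<^sub>R X (c t))) (at t)"
      using vector_derivative_diff_chain_within[of c "(- s) *\<^sub>R X (c t)" t UNIV W "DW (c t)"] c_der[of t]
        has_derivative_at_withinI[OF DW[OF that], of "range c"] by simp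
    then show ?thesis
      using linear_scale[OF has_derivative_linear[OF DW[OF that]], of "- s"]
      by (simp add: o_def has_real_derivative_iff_has_vector_derivative)
  qed
  have Wdec: "W (c t) < W (c 0)" if "t > 0" and "\<And>r. 0 \<le> r \<Longrightarrow> r \<le> t \<Longrightarrow> c r \<in> cball 0 \<delta>" for t
  proof (rule DERIV_neg_imp_decreasing[OF that(1)])
    fix r assume "0 \<le> r" "r \<le> t"
    then have "c r \<in> cball 0 \<delta>" using that by blast
    then show "\<exists>y. ((\<lambda>t. W (c t)) has_real_derivative y) (at r) \<and> y < 0"
      using Wc inc c_nz by (intro exI[of _ "- (s * DW (c r) (X (c r)))"]) auto
  qed
  have stay: "c t \<in> ball 0 \<delta>" if "t \<ge> 0" for t
  proof (rule ccontr)
    assume out: "c t \<notin> ball 0 \<delta>"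
    \<comment> \<open>The least element of this compact set is the first exit time; before it W
      decreases, and at it the norm is exactly \<delta>.\<close>
    define E where "E = {0..t} \<inter> {r. \<delta> \<le> norm (c r)}"
    have "closed {r. \<delta> \<le> norm (c r)}"
      by (intro closed_Collect_le continuous_on_norm c_cont) auto
    then have "compact E" unfolding E_def by (intro compact_Int_closed) auto
    moreover have "t \<in> E" using out that by (auto simp: E_def)
    ultimately obtain r where r: "r \<in> E" and rmin: "\<And>q. q \<in> E \<Longrightarrow> r \<le> q"
      using compact_attains_inf[of E] by blast
    have "r \<noteq> 0" using r u(3) c0 by (auto simp: E_def)
    then have "r > 0" using r by (auto simp: E_def)
    have before: "norm (c q) < \<delta>" if "0 \<le> q" "q < r" for q
      using rmin[of q] that r by (force simp: E_def)
    have "norm (c r) \<le> \<delta>"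
    proof (rule tendsto_upperbound)
      have "isCont c r" using has_vector_derivative_continuous[OF c_der] .
      then show "((\<lambda>q. norm (c q)) \<longlongrightarrow> norm (c r)) (at_left r)"
        by (intro tendsto_norm) (simp add: isCont_def filterlim_at_split)
      have "\<forall>\<^sub>F q in at_left r. q \<in> {0<..<r}"
        using \<open>r > 0\<close> by (rule eventually_at_left_real)
      then show "\<forall>\<^sub>F q in at_left r. norm (c q) \<le> \<delta>"
        by eventually_elim (use before in \<open>auto intro: less_imp_le\<close>)
    qed auto
    with r have cr: "norm (c r) = \<delta>" by (auto simp: E_def)
    have "W (c r) < W (c 0)"
    proof (rule Wdec[OF \<open>r > 0\<close>])
      show "c q \<in> cball 0 \<delta>" if "0 \<le> q" "q \<le> r" for q
        using before[of q] that cr by (cases "q = r") auto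
    qed
    moreover have "W um \<le> W (c r)" using cr by (intro m) simp
    ultimately show False using u(1) c0 by simp
  qed
  have "W (c T) < W (c 0)"
    using stay by (intro Wdec[OF \<open>T > 0\<close>]) (auto intro: less_imp_le)
  then show False by (simp add: cT c0)
qed

section \<open>Comparison of center manifolds\<close>

lemma zero_1_jet_small:
  assumes "zero_1_jet g" "0 < \<eta>"
  shows "\<forall>\<^sub>F u in nhds 0. \<bar>g u\<bar> \<le> \<eta> * norm u"
proof -
  from assms obtain d where "d > 0" "\<And>u. norm (u - 0) < d \<Longrightarrow> norm (g u - g 0 - 0) \<le> \<eta> * norm (u - 0)"
    unfolding zero_1_jet_def has_derivative_at_alt by blast
  then show ?thesis
    using assms(1) unfolding eventually_nhds_metric by (auto simp: zero_1_jet_def)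
qed

lemma eventually_graph_in_ball:
  fixes h :: "real \<times> real \<Rightarrow> real"
  assumes "zero_1_jet h" "0 < \<rho>"
  shows "\<forall>\<^sub>F u in nhds 0. (fst u, snd u, h u) \<in> ball 0 \<rho>"
proof -
  have "\<forall>\<^sub>F u :: real \<times> real in nhds 0. u \<in> ball 0 (\<rho> / 2)"
    using assms by (intro eventually_nhds_in_open) auto
  with zero_1_jet_small[OF assms(1) zero_less_one] show ?thesis
  proof eventually_elim
    case (elim u)
    then show ?case using norm_triple_le[of u "h u"] by simp
  qed
qed

text \<open>Near the origin both graphs lie in a ball on which \<open>G\<close> has Lipschitz
  constant at most \<eta>.\<close>

lemma restrict_to_diff_small:
  assumes G: "C11_near_0 G D" "zero_1_jet G" and h: "zero_1_jet h" "zero_1_jet h'" and "0 < \<eta>"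
  shows "\<forall>\<^sub>F u in nhds 0. \<bar>restrict_to h' G u - restrict_to h G u\<bar> \<le> \<eta> * \<bar>h' u - h u\<bar>"
proof -
  obtain \<epsilon> L where GB: "C11_ball \<epsilon> L G D" using G(1) by (rule C11_near_0_imp_ball)
  note L = C11_ball_pos[OF GB]
  define \<rho> where "\<rho> = min \<epsilon> (\<eta> / L)"
  have \<rho>: "0 < \<rho>" "\<rho> \<le> \<epsilon>" using L \<open>0 < \<eta>\<close> by (auto simp: \<rho>_def)
  have "L * \<rho> \<le> L * (\<eta> / L)" using L by (intro mult_left_mono) (auto simp: \<rho>_def)
  then have L\<rho>: "L * \<rho> \<le> \<eta>" using L by simp
  from eventually_graph_in_ball[OF h(1) \<rho>(1)] eventually_graph_in_ball[OF h(2) \<rho>(1)] show ?thesis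
  proof eventually_elim
    case (elim u)
    have "\<bar>restrict_to h' G u - restrict_to h G u\<bar> \<le> L * \<rho> * norm ((fst u, snd u, h' u) - (fst u, snd u, h u))"
      unfolding restrict_to_eq by (rule C11_ball_mvt[OF GB G(2) \<rho>(2) elim])
    also have "\<dots> = (L * \<rho>) * \<bar>h' u - h u\<bar>" by (simp add: norm_Pair)
    also have "\<dots> \<le> \<eta> * \<bar>h' u - h u\<bar>" using L\<rho> by (intro mult_right_mono) auto
    finally show ?case .
  qed
qed

lemma center_manifold_has_derivative:
  assumes "center_manifold X U (Suc r) h V" "u \<in> V"
  shows "(h has_derivative frechet_derivative h (at u)) (at u)"
proof -
  from assms obtain L where "(h has_derivative L) (at u)" by (auto simp: center_manifold_def)
  then have "h differentiable (at u)" by (rule differentiableI)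
  then show ?thesis by (rule frechet_derivative_works[THEN iffD1])
qed

text \<open>The difference is transported along the field of \<open>h'\<close>. Subtracting the two
  invariance equations leaves the change of \<open>R\<close> and, since \<open>h\<close> is
  invariant for its own field, \<open>Dh\<close> applied to the difference of the fields. These are
  three small terms, from \<open>P\<close>, \<open>Q\<close> and \<open>R\<close>, each with a share
  \<eta>/3.\<close>

lemma center_manifolds_agree:
  assumes lam: "lam \<noteq> 0"
    and PQR: "C11_near_0 P DP" "C11_near_0 Q DQ" "C11_near_0 R DR" "zero_1_jet P" "zero_1_jet Q" "zero_1_jet R"
    and h: "center_manifold (field3 lam P Q R) U (Suc (Suc r)) h V"
    and h': "center_manifold (field3 lam P Q R) U' (Suc r') h' V'"
  obtains C where "C \<ge> 0" "\<forall>\<^sub>F u in nhds 0. \<bar>h' u - h u\<bar> \<le> C * norm u ^ k"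
proof -
  have V: "open V" "0 \<in> V" "open V'" "0 \<in> V'" and jet: "zero_1_jet h" "zero_1_jet h'"
    and "Ck_on (Suc (Suc r)) h V"
    using h h' by (auto simp: center_manifold_def)
  then obtain Dh where Dh: "C11_near_0 h Dh" using C2_imp_C11 by blast
  then obtain \<epsilon> L where hB: "C11_ball \<epsilon> L h Dh" by (rule C11_near_0_imp_ball)
  note \<epsilon>L = C11_ball_pos[OF hB]
  define Dh' where "Dh' u = frechet_derivative h' (at u)" for u
  define p where "p = restrict_to h P"
  define q where "q = restrict_to h Q"
  define p' where "p' = restrict_to h' P"
  define q' where "q' = restrict_to h' Q"
  have ev: "\<forall>\<^sub>F u in nhds 0. u \<in> V \<and> u \<in> V' \<and> u \<in> ball 0 (min \<epsilon> (1 / L))"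
    using V \<epsilon>L by (intro eventually_conj eventually_nhds_in_open) auto
  show ?thesis
  proof (rule flat_of_transport[where d = "\<lambda>u. h' u - h u" and p = p' and q = q' and lam = lam
        and k = k and Dd = "\<lambda>u w. Dh' u w - Dh u w", OF lam])
    show "h' 0 - h 0 = 0" using jet by (simp add: zero_1_jet_def)
    show "\<forall>\<^sub>F u in nhds 0. ((\<lambda>u. h' u - h u) has_derivative (\<lambda>w. Dh' u w - Dh u w)) (at u)"
      using ev
    proof eventually_elim
      case (elim u)
      then show ?case
        unfolding Dh'_def using C11_ball_has_derivative[OF hB, of u]
        by (intro has_derivative_diff center_manifold_has_derivative[OF h']) auto
    qed
    fix \<eta> :: real assume \<eta>: "\<eta> > 0"
    show "\<forall>\<^sub>F u in nhds 0. \<bar>p' u\<bar> \<le> \<eta> * norm u" "\<forall>\<^sub>F u in nhds 0. \<bar>q' u\<bar> \<le> \<eta> * norm u"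
      unfolding p'_def q'_def by (intro zero_1_jet_small zero_1_jet_restrict_to jet PQR \<eta>)+
    have "0 < \<eta> / 3" using \<eta> by simp
    note diff = restrict_to_diff_small[OF _ _ jet this]
    show "\<forall>\<^sub>F u in nhds 0. \<bar>Dh' u (planar_field p' q' u) - Dh u (planar_field p' q' u) + lam * (h' u - h u)\<bar>
        \<le> \<eta> * \<bar>h' u - h u\<bar>"
      using ev diff[OF PQR(1,4)] diff[OF PQR(2,5)] diff[OF PQR(3,6)]
    proof eventually_elim
      case (elim u)
      define d where "d = \<bar>h' u - h u\<bar>"
      have u: "u \<in> ball 0 \<epsilon>" "L * norm u \<le> 1" using elim(1) \<epsilon>L by (auto simp: field_simps)
      have lin: "linear (Dh u)" using C11_ball_has_derivative[OF hB u(1)] by (rule has_derivative_linear)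
      have e: "Dh' u (planar_field p' q' u) = - lam * h' u + restrict_to h' R u"
        unfolding Dh'_def p'_def q'_def
        using elim(1) by (intro center_manifold_invariance[OF h'] center_manifold_has_derivative[OF h']) auto
      have e2: "Dh u (planar_field p q u) = - lam * h u + restrict_to h R u"
        unfolding p_def q_def
        using elim(1) by (intro center_manifold_invariance[OF h] C11_ball_has_derivative[OF hB u(1)]) auto
      have "planar_field p' q' u - planar_field p q u = (p' u - p u, q' u - q u)"
        by (simp add: planar_field_def case_prod_unfold)
      then have e3: "Dh u (planar_field p' q' u) = Dh u (planar_field p q u) + Dh u (p' u - p u, q' u - q u)"
        using linear_diff[OF lin, of "planar_field p' q' u" "planar_field p q u"] by simp
      have "\<bar>Dh u (p' u - p u, q' u - q u)\<bar> \<le> (L * norm u) * norm (p' u - p u, q' u - q u)"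
        by (rule C11_ball_deriv_le[OF hB jet(1) u(1)])
      also have "\<dots> \<le> 1 * (\<bar>p' u - p u\<bar> + \<bar>q' u - q u\<bar>)"
        using u(2) norm_Pair_le[of "p' u - p u" "q' u - q u"] by (intro mult_mono) auto
      also have "\<dots> \<le> \<eta> / 3 * d + \<eta> / 3 * d"
        using elim(2,3) by (simp add: p_def p'_def q_def q'_def d_def)
      finally have "\<bar>Dh u (p' u - p u, q' u - q u)\<bar> \<le> \<eta> / 3 * d + \<eta> / 3 * d" .
      moreover have "\<bar>restrict_to h' R u - restrict_to h R u\<bar> \<le> \<eta> / 3 * d" using elim(4) by (simp add: d_def)
      moreover have "Dh' u (planar_field p' q' u) - Dh u (planar_field p' q' u) + lam * (h' u - h u)
          = (restrict_to h' R u - restrict_to h R u) - Dh u (p' u - p u, q' u - q u)"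
        unfolding e e3 e2 by (simp add: algebra_simps)
      ultimately show ?case unfolding d_def[symmetric] by linarith
    qed
  qed (rule that)
qed

text \<open>The Landau symbol ignores the point 0; the second assumption adds it.\<close>

lemma leading_term_eventually:
  assumes "leading_term g c k" "g 0 = c * 0 ^ k"
  obtains C where "C > 0" "\<forall>\<^sub>F x in nhds 0. \<bar>g x - c * x ^ k\<bar> \<le> C * \<bar>x\<bar> ^ (k + 1)"
proof -
  from assms(1) obtain C where C: "C > 0" "\<forall>\<^sub>F x in at 0. norm (g x - c * x ^ k) \<le> C * norm (x ^ (k + 1))"
    unfolding leading_term_def by (auto elim: landau_o.bigE)
  then have "\<forall>\<^sub>F x in nhds 0. x \<noteq> 0 \<longrightarrow> norm (g x - c * x ^ k) \<le> C * norm (x ^ (k + 1))"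
    by (simp add: eventually_at_filter)
  then have "\<forall>\<^sub>F x in nhds 0. \<bar>g x - c * x ^ k\<bar> \<le> C * \<bar>x\<bar> ^ (k + 1)"
  proof eventually_elim
    case (elim x)
    then show ?case using assms(2) by (cases "x = 0") (auto simp: power_abs abs_mult)
  qed
  with C(1) show ?thesis by (rule that)
qed

section \<open>Expansion along the branch y = F(x)\<close>

locale planar_branch =
  fixes p q :: "real \<times> real \<Rightarrow> real" and Dp Dq and F :: "real \<Rightarrow> real" and \<epsilon> L :: real
  assumes p: "C11_ball \<epsilon> L p Dp" "zero_1_jet p" and q: "C11_ball \<epsilon> L q Dq" "zero_1_jet q"
    and F: "solves_branch p F"
begin

lemma pos: "0 < \<epsilon>" "0 < L"
  using C11_ball_pos[OF p(1)] by auto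

text \<open>On this ball \<open>p\<close> has Lipschitz constant at most 1/2, so that y + p(x,y) and
  y - F(x) are comparable.\<close>

definition rad :: real where "rad = min \<epsilon> (1 / (2 * L))"

lemma rad: "0 < rad" "rad \<le> \<epsilon>" "L * rad \<le> 1 / 2"
proof -
  show "0 < rad" "rad \<le> \<epsilon>" using pos by (auto simp: rad_def)
  have "L * rad \<le> L * (1 / (2 * L))" using pos by (intro mult_left_mono) (auto simp: rad_def)
  then show "L * rad \<le> 1 / 2" using pos by simp
qed

lemma Lnorm_le: "u \<in> ball 0 rad \<Longrightarrow> L * norm u \<le> 1 / 2"
  using order_trans[OF mult_left_mono[of "norm u" rad L] rad(3)] pos by simp

lemma eventually_branch:
  "\<forall>\<^sub>F x in nhds 0. (x, F x) \<in> ball 0 rad \<and> F x + p (x, F x) = 0 \<and> \<bar>F x\<bar> \<le> \<bar>x\<bar>"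
proof -
  have F0: "F 0 = 0" and Fc: "isCont F 0" and Fp: "\<forall>\<^sub>F x in nhds 0. F x + p (x, F x) = 0"
    using F by (auto simp: solves_branch_def)
  have "isCont (\<lambda>x. (x, F x)) 0" using Fc by (intro continuous_intros)
  then have "((\<lambda>x. (x, F x)) \<longlongrightarrow> (0, F 0)) (nhds 0)"
    unfolding isCont_def tendsto_at_iff_tendsto_nhds[of "\<lambda>x. (x, F x)"] .
  then have "\<forall>\<^sub>F x in nhds 0. (x, F x) \<in> ball 0 rad"
    using rad(1) by (intro topological_tendstoD) (auto simp: F0 zero_prod_def[symmetric])
  with Fp show ?thesis
  proof eventually_elim
    case (elim x)
    let ?v = "(x, F x)"
    \<comment> \<open>As F x = -p(x, F x), the resulting bound by half of |x| + |F x| yields |F x|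
      \<le> |x|.\<close>
    have "\<bar>p ?v\<bar> \<le> L * norm ?v ^ 2"
      using elim(2) rad(2) by (intro C11_ball_quadratic[OF p]) auto
    also have "\<dots> = (L * norm ?v) * norm ?v" by (simp add: power2_eq_square)
    also have "\<dots> \<le> 1 / 2 * (\<bar>x\<bar> + \<bar>F x\<bar>)"
      using Lnorm_le[OF elim(2)] norm_Pair_le[of x "F x"] pos by (intro mult_mono) auto
    finally show ?case using elim by auto
  qed
qed

lemma Phi_along_eq:
  assumes "(x, F x) \<in> ball 0 rad"
  shows "Phi_along p q F x = Dp (x, F x) (1, 0) + Dq (x, F x) (0, 1)"
proof -
  have v: "(x, F x) \<in> ball 0 \<epsilon>" using assms rad by auto
  have 1: "((\<lambda>s. p (s, F x)) has_derivative (\<lambda>s. Dp (x, F x) (s, 0))) (at x)"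
    using diff_chain_at[OF has_derivative_Pair[OF has_derivative_ident has_derivative_const]
        C11_ball_has_derivative[OF p(1) v]] by (simp add: o_def)
  have 2: "((\<lambda>s. q (x, s)) has_derivative (\<lambda>s. Dq (x, F x) (0, s))) (at (F x))"
    using diff_chain_at[OF has_derivative_Pair[OF has_derivative_const has_derivative_ident]
        C11_ball_has_derivative[OF q(1) v]] by (simp add: o_def)
  have 3: "(\<lambda>s. Dp (x, F x) (s, 0)) = (*) (Dp (x, F x) (1, 0))"
  proof
    fix s
    show "Dp (x, F x) (s, 0) = Dp (x, F x) (1, 0) * s"
      using linear_scale[OF has_derivative_linear[OF C11_ball_has_derivative[OF p(1) v]], of s "(1, 0)"] by simp
  qed
  have 4: "(\<lambda>s. Dq (x, F x) (0, s)) = (*) (Dq (x, F x) (0, 1))"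
  proof
    fix s
    show "Dq (x, F x) (0, s) = Dq (x, F x) (0, 1) * s"
      using linear_scale[OF has_derivative_linear[OF C11_ball_has_derivative[OF q(1) v]], of s "(0, 1)"] by simp
  qed
  have "((\<lambda>s. p (s, F x)) has_real_derivative Dp (x, F x) (1, 0)) (at x)"
    "((\<lambda>s. q (x, s)) has_real_derivative Dq (x, F x) (0, 1)) (at (F x))"
    using 1 2 unfolding 3 4 by (auto simp only: has_field_derivative_def)
  then show ?thesis by (simp add: Phi_along_def DERIV_imp_deriv)
qed

lemma abs_Phi_along_le:
  assumes "(x, F x) \<in> ball 0 rad" "\<bar>F x\<bar> \<le> \<bar>x\<bar>"
  shows "\<bar>Phi_along p q F x\<bar> \<le> 4 * L * \<bar>x\<bar>"
proof -
  have v: "(x, F x) \<in> ball 0 \<epsilon>" using assms rad by auto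
  have "\<bar>Phi_along p q F x\<bar> \<le> L * norm (x, F x) * norm (1::real, 0::real) + L * norm (x, F x) * norm (0::real, 1::real)"
    unfolding Phi_along_eq[OF assms(1)]
    by (rule order_trans[OF abs_triangle_ineq add_mono[OF C11_ball_deriv_le[OF p v] C11_ball_deriv_le[OF q v]]])
  also have "\<dots> = 2 * (L * norm (x, F x))" by (simp add: norm_Pair)
  also have "\<dots> \<le> 2 * (L * (2 * \<bar>x\<bar>))"
    using pos norm_Pair_le[of x "F x"] assms(2) by (intro mult_left_mono) auto
  finally show ?thesis by simp
qed

lemma f_along_0: "f_along q F 0 = 0" and Phi_along_0: "Phi_along p q F 0 = 0"
proof -
  have "F 0 = 0" using F by (auto simp: solves_branch_def)
  then show "f_along q F 0 = 0" using q(2) by (simp add: f_along_def zero_1_jet_def zero_prod_def)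
  show "Phi_along p q F 0 = 0"
    using abs_Phi_along_le[of 0] \<open>F 0 = 0\<close> rad(1) by (simp add: zero_prod_def[symmetric])
qed

text \<open>Both components start at order two, so \<Phi> is O(x) along the branch. With \<beta> = n
  - 1 this rules out n = 1.\<close>

lemma Phi_along_no_constant_term: "\<not> leading_term (Phi_along p q F) b 0"
proof
  assume lt: "leading_term (Phi_along p q F) b 0"
  then have "b \<noteq> 0" by (simp add: leading_term_def)
  from lt obtain C where C: "\<forall>\<^sub>F x in at 0. norm (Phi_along p q F x - b * x ^ 0) \<le> C * norm (x ^ (0 + 1))"
    unfolding leading_term_def by (auto elim: landau_o.bigE)
  have "\<forall>\<^sub>F x in at 0. (x, F x) \<in> ball 0 rad \<and> F x + p (x, F x) = 0 \<and> \<bar>F x\<bar> \<le> \<bar>x\<bar>"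
    using eventually_branch unfolding eventually_at_filter by (rule eventually_mono) blast
  with C have "\<forall>\<^sub>F x in at 0. \<bar>b\<bar> \<le> (C + 4 * L) * \<bar>x\<bar>"
  proof eventually_elim
    case (elim x)
    then show ?case using abs_Phi_along_le[of x] by (simp add: distrib_right)
  qed
  moreover have "((\<lambda>x. (C + 4 * L) * \<bar>x\<bar>) \<longlongrightarrow> (C + 4 * L) * \<bar>0\<bar>) (at 0)"
    by (intro tendsto_intros)
  ultimately have "\<bar>b\<bar> \<le> (C + 4 * L) * \<bar>0\<bar>"
    by (intro tendsto_lowerbound) auto
  with \<open>b \<noteq> 0\<close> show False by simp
qed

text \<open>With \<open>Y = y + p(x,y)\<close> and \<open>w = y - F x\<close> one has \<open>Y = (1 + p\<^sub>y) w + O(w\<^sup>2)\<close>, so expanding at the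
  point \<open>(x, F x)\<close> the derivative of \<open>Y\<close> along the field becomes \<open>f + \<Phi> Y + p\<^sub>y f + O(Y\<^sup>2)\<close>.\<close>

lemma branch_expansion:
  assumes f: "leading_term (f_along q F) a (2 * n - 1)" and \<Phi>: "leading_term (Phi_along p q F) b (n - 1)"
    and n: "1 < n"
  obtains C where "0 \<le> C"
    "\<forall>\<^sub>F u in nhds 0. norm u \<le> 2 * (\<bar>fst u\<bar> + \<bar>snd u + p u\<bar>) \<and>
       \<bar>(1 + Dp u (0, 1)) * q u + Dp u (1, 0) * (snd u + p u)
          - (a * fst u ^ (2 * n - 1) + b * fst u ^ (n - 1) * (snd u + p u))\<bar>
       \<le> C * (\<bar>fst u\<bar> ^ (2 * n) + \<bar>fst u\<bar> ^ n * \<bar>snd u + p u\<bar> + (snd u + p u) ^ 2)"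
proof -
  have e: "2 * n - 1 + 1 = 2 * n" "n - 1 + 1 = n" using n by auto
  have z: "f_along q F 0 = a * 0 ^ (2 * n - 1)" "Phi_along p q F 0 = b * 0 ^ (n - 1)"
    using zero_power[of "2 * n - 1"] zero_power[of "n - 1"] n by (simp_all only: f_along_0 Phi_along_0) simp_all
  obtain Cf where Cf: "0 < Cf" "\<forall>\<^sub>F x in nhds 0. \<bar>f_along q F x - a * x ^ (2 * n - 1)\<bar> \<le> Cf * \<bar>x\<bar> ^ (2 * n)"
    by (rule leading_term_eventually[OF f z(1), unfolded e])
  obtain C\<Phi> where C\<Phi>: "0 < C\<Phi>" "\<forall>\<^sub>F x in nhds 0. \<bar>Phi_along p q F x - b * x ^ (n - 1)\<bar> \<le> C\<Phi> * \<bar>x\<bar> ^ n"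
    by (rule leading_term_eventually[OF \<Phi> z(2), unfolded e])
  \<comment> \<open>\<open>K\<close> bounds the product of p_y and f in \<open>b5\<close>; in
    \<open>C\<close>, 14 = 4 + 8 + 2 collects the quadratic remainders \<open>b1\<close>,
    \<open>b2\<close> and \<open>b3\<close>.\<close>
  define K where "K = 2 * L * (\<bar>a\<bar> + Cf)"
  define C where "C = Cf + C\<Phi> + K + 14 * L"
  have K: "0 \<le> K" using pos Cf by (simp add: K_def)
  have "\<forall>\<^sub>F x in nhds 0. \<bar>f_along q F x - a * x ^ (2 * n - 1)\<bar> \<le> Cf * \<bar>x\<bar> ^ (2 * n) \<and>
      \<bar>Phi_along p q F x - b * x ^ (n - 1)\<bar> \<le> C\<Phi> * \<bar>x\<bar> ^ n \<and>
      ((x, F x) \<in> ball 0 rad \<and> F x + p (x, F x) = 0 \<and> \<bar>F x\<bar> \<le> \<bar>x\<bar>)"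
    by (intro eventually_conj Cf C\<Phi> eventually_branch)
  moreover have "filterlim fst (nhds 0) (nhds (0 :: real \<times> real))"
    using tendsto_fst[OF tendsto_ident_at, of "0 :: real \<times> real" UNIV]
    unfolding tendsto_at_iff_tendsto_nhds[of fst] by simp
  ultimately have "\<forall>\<^sub>F u :: real \<times> real in nhds 0. \<bar>f_along q F (fst u) - a * fst u ^ (2 * n - 1)\<bar> \<le> Cf * \<bar>fst u\<bar> ^ (2 * n) \<and>
      \<bar>Phi_along p q F (fst u) - b * fst u ^ (n - 1)\<bar> \<le> C\<Phi> * \<bar>fst u\<bar> ^ n \<and>
      ((fst u, F (fst u)) \<in> ball 0 rad \<and> F (fst u) + p (fst u, F (fst u)) = 0 \<and> \<bar>F (fst u)\<bar> \<le> \<bar>fst u\<bar>)"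
    by (rule eventually_compose_filterlim)
  moreover have "\<forall>\<^sub>F u :: real \<times> real in nhds 0. u \<in> ball 0 (min rad 1)"
    using rad(1) by (intro eventually_nhds_in_open) auto
  ultimately have "\<forall>\<^sub>F u in nhds 0. norm u \<le> 2 * (\<bar>fst u\<bar> + \<bar>snd u + p u\<bar>) \<and>
       \<bar>(1 + Dp u (0, 1)) * q u + Dp u (1, 0) * (snd u + p u)
          - (a * fst u ^ (2 * n - 1) + b * fst u ^ (n - 1) * (snd u + p u))\<bar>
       \<le> C * (\<bar>fst u\<bar> ^ (2 * n) + \<bar>fst u\<bar> ^ n * \<bar>snd u + p u\<bar> + (snd u + p u) ^ 2)"
  proof eventually_elim
    case (elim u)
    obtain x y where u: "u = (x, y)" by (cases u)
    define v where "v = (x, F x)"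
    define w where "w = y - F x"
    define Y where "Y = y + p u"
    define fx where "fx = f_along q F x"
    define \<phi> where "\<phi> = Phi_along p q F x"
    from elim have fx: "\<bar>fx - a * x ^ (2 * n - 1)\<bar> \<le> Cf * \<bar>x\<bar> ^ (2 * n)"
      and \<phi>: "\<bar>\<phi> - b * x ^ (n - 1)\<bar> \<le> C\<Phi> * \<bar>x\<bar> ^ n"
      and v: "v \<in> ball 0 rad" and Fp: "F x + p v = 0" and Fx: "\<bar>F x\<bar> \<le> \<bar>x\<bar>"
      and u1: "u \<in> ball 0 rad" "norm u < 1"
      by (auto simp: u fx_def \<phi>_def v_def)
    have uv\<epsilon>: "u \<in> ball 0 \<epsilon>" "v \<in> ball 0 \<epsilon>" using u1 v rad(2) by auto
    have uv: "u - v = (0, w)" "v - u = (- w) *\<^sub>R (0, 1)" by (auto simp: u v_def w_def)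
    have nuv: "norm (u - v) = \<bar>w\<bar>" "norm (v - u) = \<bar>w\<bar>" by (auto simp: uv norm_Pair)
    have x1: "\<bar>x\<bar> \<le> 1" using u1(2) norm_fst_le[of x y] by (simp add: u)
    have "\<bar>p u - p v\<bar> \<le> (L * rad) * norm (u - v)"
      by (rule C11_ball_mvt[OF p rad(2) v u1(1)])
    also have "\<dots> \<le> 1 / 2 * \<bar>w\<bar>" unfolding nuv using rad(3) by (intro mult_right_mono) auto
    finally have "\<bar>p u - p v\<bar> \<le> 1 / 2 * \<bar>w\<bar>" .
    moreover have Yw: "Y = w + (p u - p v)" using Fp by (simp add: Y_def w_def)
    ultimately have w: "\<bar>w\<bar> \<le> 2 * \<bar>Y\<bar>" by linarith
    have nu: "norm u \<le> 2 * (\<bar>x\<bar> + \<bar>Y\<bar>)"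
      using norm_Pair_le[of x y] w Fx by (simp add: u w_def)
    have w2: "w ^ 2 \<le> 4 * Y ^ 2"
      using power_mono[OF w, of 2] by (simp add: power_mult_distrib)
    define py where "py = Dp u (0, 1)"
    define qy where "qy = Dq v (0, 1)"
    \<comment> \<open>\<open>p\<close> is expanded at u and \<open>q\<close> at the branch point v:
      then w appears with the very factor 1 + p_y(u) that multiplies q in the derivative of
      Y.\<close>
    define ep where "ep = Y - w * (1 + py)"
    define eq where "eq = q u - fx - w * qy"
    have "\<bar>p v - p u - Dp u (v - u)\<bar> \<le> L * norm (v - u) ^ 2"
      by (rule C11_ball_taylor[OF p(1) uv\<epsilon>])
    moreover have "Dp u (v - u) = - w * py"
      unfolding uv py_def
      using linear_scale[OF has_derivative_linear[OF C11_ball_has_derivative[OF p(1) uv\<epsilon>(1)]], of "- w" "(0, 1)"] by simp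
    ultimately have ep: "\<bar>ep\<bar> \<le> L * w ^ 2"
      unfolding ep_def Yw nuv by (simp add: algebra_simps abs_minus_commute)
    have "\<bar>q u - q v - Dq v (u - v)\<bar> \<le> L * norm (u - v) ^ 2"
      by (rule C11_ball_taylor[OF q(1) uv\<epsilon>(2,1)])
    moreover have "Dq v (u - v) = w * qy"
      unfolding uv qy_def
      using linear_scale[OF has_derivative_linear[OF C11_ball_has_derivative[OF q(1) uv\<epsilon>(2)]], of w "(0, 1)"] by simp
    moreover have "fx = q v" by (simp add: fx_def f_along_def v_def)
    ultimately have eq: "\<bar>eq\<bar> \<le> L * w ^ 2"
      unfolding eq_def nuv by simp
    have py: "\<bar>py\<bar> \<le> L * norm u"
      using C11_ball_deriv_le[OF p uv\<epsilon>(1), of "(0, 1)"] by (simp add: py_def norm_Pair)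
    then have py1: "\<bar>1 + py\<bar> \<le> 2" using Lnorm_le[OF u1(1)] by linarith
    have "\<bar>qy\<bar> \<le> L * norm v"
      using C11_ball_deriv_le[OF q uv\<epsilon>(2), of "(0, 1)"] by (simp add: qy_def norm_Pair)
    then have qy: "\<bar>qy\<bar> \<le> 1" using Lnorm_le[OF v] by linarith
    define dpx where "dpx = Dp u (1, 0) - Dp v (1, 0)"
    have dpx: "\<bar>dpx\<bar> \<le> L * \<bar>w\<bar>"
      using C11_ball_lipschitz[OF p(1) uv\<epsilon>, of "(1, 0)"] by (simp add: dpx_def nuv norm_Pair)
    have \<phi>_eq: "\<phi> = Dp v (1, 0) + qy"
      using Phi_along_eq[of x] v by (simp add: \<phi>_def qy_def v_def)
    \<comment> \<open>Insert q u = fx + w qy + eq and replace w (1 + py) by Y - ep; the coefficients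
      of Y then combine to \<phi>, up to the change \<open>dpx\<close> of p_x between u and
      v.\<close>
    have split: "(1 + py) * q u + Dp u (1, 0) * Y - (a * x ^ (2 * n - 1) + b * x ^ (n - 1) * Y)
        = (fx - a * x ^ (2 * n - 1)) + (\<phi> - b * x ^ (n - 1)) * Y + py * fx - ep * qy + (1 + py) * eq + dpx * Y"
      unfolding \<phi>_eq dpx_def eq_def ep_def by (simp add: algebra_simps)
    have b1: "\<bar>ep * qy\<bar> \<le> 4 * L * Y ^ 2"
    proof -
      have "\<bar>ep * qy\<bar> \<le> (L * w ^ 2) * 1" unfolding abs_mult using ep qy by (intro mult_mono) auto
      also have "\<dots> \<le> L * (4 * Y ^ 2)" using w2 pos by simp
      finally show ?thesis by simp
    qed
    have b2: "\<bar>(1 + py) * eq\<bar> \<le> 8 * L * Y ^ 2"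
    proof -
      have "\<bar>(1 + py) * eq\<bar> \<le> 2 * (L * w ^ 2)" unfolding abs_mult using eq py1 by (intro mult_mono) auto
      also have "\<dots> \<le> 2 * (L * (4 * Y ^ 2))" using w2 pos by simp
      finally show ?thesis by simp
    qed
    have b3: "\<bar>dpx * Y\<bar> \<le> 2 * L * Y ^ 2"
    proof -
      have "\<bar>dpx * Y\<bar> \<le> (L * (2 * \<bar>Y\<bar>)) * \<bar>Y\<bar>"
        unfolding abs_mult using dpx w pos by (intro mult_right_mono order_trans[OF dpx] mult_left_mono) auto
      also have "\<dots> = 2 * L * Y ^ 2" by (simp add: power2_eq_square)
      finally show ?thesis .
    qed
    have b4: "\<bar>(\<phi> - b * x ^ (n - 1)) * Y\<bar> \<le> C\<Phi> * (\<bar>x\<bar> ^ n * \<bar>Y\<bar>)"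
      using mult_right_mono[OF \<phi>, of "\<bar>Y\<bar>"] by (simp add: abs_mult mult.assoc)
    have b5: "\<bar>py * fx\<bar> \<le> K * (\<bar>x\<bar> ^ (2 * n) + \<bar>x\<bar> ^ n * \<bar>Y\<bar>)"
    proof -
      have "\<bar>fx\<bar> \<le> \<bar>a * x ^ (2 * n - 1)\<bar> + Cf * \<bar>x\<bar> ^ (2 * n)" using fx by linarith
      also have "\<dots> \<le> \<bar>a\<bar> * \<bar>x\<bar> ^ (2 * n - 1) + Cf * \<bar>x\<bar> ^ (2 * n - 1)"
        unfolding abs_mult power_abs using x1 Cf by (intro add_mono mult_left_mono power_decreasing) auto
      finally have "\<bar>fx\<bar> \<le> (\<bar>a\<bar> + Cf) * \<bar>x\<bar> ^ (2 * n - 1)" by (simp add: algebra_simps)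
      then have "\<bar>py * fx\<bar> \<le> (L * (2 * (\<bar>x\<bar> + \<bar>Y\<bar>))) * ((\<bar>a\<bar> + Cf) * \<bar>x\<bar> ^ (2 * n - 1))"
        unfolding abs_mult using py nu pos
        by (intro mult_mono) (auto intro: order_trans[OF py] mult_left_mono)
      also have "\<dots> = K * (\<bar>x\<bar> * \<bar>x\<bar> ^ (2 * n - 1) + \<bar>x\<bar> ^ (2 * n - 1) * \<bar>Y\<bar>)"
        by (simp add: K_def algebra_simps)
      also have "\<bar>x\<bar> * \<bar>x\<bar> ^ (2 * n - 1) = \<bar>x\<bar> ^ (2 * n)"
        using n by (simp add: power_Suc[symmetric] del: power_Suc)
      also have "K * (\<bar>x\<bar> ^ (2 * n) + \<bar>x\<bar> ^ (2 * n - 1) * \<bar>Y\<bar>) \<le> K * (\<bar>x\<bar> ^ (2 * n) + \<bar>x\<bar> ^ n * \<bar>Y\<bar>)"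
        using K x1 n by (intro mult_left_mono add_left_mono mult_right_mono power_decreasing) auto
      finally show ?thesis .
    qed
    have nn: "0 \<le> \<bar>x\<bar> ^ (2 * n)" "0 \<le> \<bar>x\<bar> ^ n * \<bar>Y\<bar>" "0 \<le> Y ^ 2" by auto
    have tri: "\<bar>c1 + c2 + c3 - c4 + c5 + c6\<bar> \<le> \<bar>c1\<bar> + \<bar>c2\<bar> + \<bar>c3\<bar> + \<bar>c4\<bar> + \<bar>c5\<bar> + \<bar>c6\<bar>"
      for c1 c2 c3 c4 c5 c6 :: real by linarith
    have "\<bar>(1 + py) * q u + Dp u (1, 0) * Y - (a * x ^ (2 * n - 1) + b * x ^ (n - 1) * Y)\<bar>
        \<le> Cf * \<bar>x\<bar> ^ (2 * n) + C\<Phi> * (\<bar>x\<bar> ^ n * \<bar>Y\<bar>) + K * (\<bar>x\<bar> ^ (2 * n) + \<bar>x\<bar> ^ n * \<bar>Y\<bar>)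
          + 4 * L * Y ^ 2 + 8 * L * Y ^ 2 + 2 * L * Y ^ 2"
      unfolding split by (rule order_trans[OF tri]) (intro add_mono fx b1 b2 b3 b4 b5)
    also have "\<dots> = (Cf + K) * \<bar>x\<bar> ^ (2 * n) + (C\<Phi> + K) * (\<bar>x\<bar> ^ n * \<bar>Y\<bar>) + 14 * L * Y ^ 2"
      by (simp add: algebra_simps)
    also have "\<dots> \<le> C * \<bar>x\<bar> ^ (2 * n) + C * (\<bar>x\<bar> ^ n * \<bar>Y\<bar>) + C * Y ^ 2"
      using Cf C\<Phi> K pos by (intro add_mono mult_right_mono nn) (auto simp: C_def)
    also have "\<dots> = C * (\<bar>x\<bar> ^ (2 * n) + \<bar>x\<bar> ^ n * \<bar>Y\<bar> + Y ^ 2)" by (simp only: distrib_left)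
    finally have bound: "\<bar>(1 + py) * q u + Dp u (1, 0) * Y - (a * x ^ (2 * n - 1) + b * x ^ (n - 1) * Y)\<bar>
        \<le> C * (\<bar>x\<bar> ^ (2 * n) + \<bar>x\<bar> ^ n * \<bar>Y\<bar> + Y ^ 2)" .
    have xy: "fst u = x" "snd u = y" by (simp_all add: u)
    show ?case using nu bound unfolding xy Y_def py_def by (rule conjI)
  qed
  moreover have "0 \<le> C" using Cf C\<Phi> K pos by (simp add: C_def)
  ultimately show ?thesis using that by blast
qed

end

section \<open>Absence of a center for perturbed planar fields\<close>

lemma nhds_0_snd_add:
  assumes "p 0 = (0 :: real)" "isCont p 0"
  shows "((\<lambda>u :: real \<times> real. snd u + p u) \<longlongrightarrow> 0) (nhds 0)"
proof -
  have "isCont (\<lambda>u. snd u + p u) 0" using assms(2) by (intro continuous_intros)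
  then show ?thesis
    unfolding isCont_def tendsto_at_iff_tendsto_nhds[of "\<lambda>u. snd u + p u"] by (simp add: assms(1))
qed

context planar_branch
begin

text \<open>The coordinate Y is built from the unperturbed \<open>p\<close>, so no derivative of
  \<open>p'\<close> enters. The perturbation adds only e1 to x' and (1 + p_y) e2 + p_x e1 to Y',
  both of weight 2n.\<close>

lemma perturbed_field_not_center:
  assumes f: "leading_term (f_along q F) a (2 * n - 1)" and \<Phi>: "leading_term (Phi_along p q F) b (n - 1)"
    and n: "odd n" "1 < n" and a: "a < 0"
    and p': "\<forall>\<^sub>F u in nhds 0. \<bar>p' u - p u\<bar> \<le> K * norm u ^ (2 * n)"
    and q': "\<forall>\<^sub>F u in nhds 0. \<bar>q' u - q u\<bar> \<le> K * norm u ^ (2 * n)"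
  shows "\<not> is_center (planar_field p' q') V"
proof -
  obtain C1 where C1: "0 \<le> C1" and exp: "\<forall>\<^sub>F u in nhds 0. norm u \<le> 2 * (\<bar>fst u\<bar> + \<bar>snd u + p u\<bar>) \<and>
       \<bar>(1 + Dp u (0, 1)) * q u + Dp u (1, 0) * (snd u + p u)
          - (a * fst u ^ (2 * n - 1) + b * fst u ^ (n - 1) * (snd u + p u))\<bar>
       \<le> C1 * (\<bar>fst u\<bar> ^ (2 * n) + \<bar>fst u\<bar> ^ n * \<bar>snd u + p u\<bar> + (snd u + p u) ^ 2)"
    by (rule branch_expansion[OF f \<Phi> n(2)])
  \<comment> \<open>The norm of u will be at most 4 \<rho>, whence the power of 4. In
    \<open>C\<close>, 3 C1 bounds the expansion error and 3 K' = 2 K' + K' the two perturbation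
    terms.\<close>
  define K' where "K' = \<bar>K\<bar> * 4 ^ (2 * n)"
  define C where "C = 3 * C1 + 3 * K'"
  have K': "0 \<le> K'" by (simp add: K'_def)
  have C: "0 \<le> C" "K' \<le> C" using C1 K' by (auto simp: C_def)
  have ab: "0 < - a" "b \<noteq> 0" using a \<Phi> by (simp_all add: leading_term_def)
  obtain s \<rho>0 :: real and W Wx Wy :: "real \<Rightarrow> real \<Rightarrow> real" where Wpos: "\<And>x y. x \<noteq> 0 \<or> y \<noteq> 0 \<Longrightarrow> 0 < W x y"
    and s: "s = 1 \<or> s = -1" and "0 < \<rho>0" and W0: "W 0 0 = 0"
    and DW: "\<And>x y. ((\<lambda>u. W (fst u) (snd u)) has_derivative (\<lambda>w. Wx x y * fst w + Wy x y * snd w)) (at (x, y))"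
    and Winc: "\<And>x t E1 E2. x \<noteq> 0 \<or> t \<noteq> 0 \<Longrightarrow> max \<bar>x\<bar> \<bar>t\<bar> < \<rho>0 \<Longrightarrow>
       \<bar>E1\<bar> \<le> C * max \<bar>x\<bar> \<bar>t\<bar> ^ (2 * n) \<Longrightarrow> \<bar>E2\<bar> \<le> C * max \<bar>x\<bar> \<bar>t\<bar> ^ (2 * n) \<Longrightarrow>
       0 < s * (Wx x (t ^ n) * (t ^ n + E1) + Wy x (t ^ n) * (b * x ^ (n - 1) * t ^ n - (- a) * x ^ (2 * n - 1) + E2))"
    by (rule quasi_homogeneous_lyapunov[OF ab n C(1)], rule that, assumption+)
  define \<rho>1 where "\<rho>1 = min \<rho>0 1"
  have \<rho>1: "0 < \<rho>1" "\<rho>1 \<le> 1" "\<rho>1 \<le> \<rho>0" using \<open>0 < \<rho>0\<close> by (auto simp: \<rho>1_def)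
  have p_cont: "isCont p 0"
    using C11_ball_has_derivative[OF p(1), of 0] pos by (intro has_derivative_continuous) auto
  have "p 0 = 0" using p(2) by (simp add: zero_1_jet_def)
  from nhds_0_snd_add[OF this p_cont]
  \<comment> \<open>The n-th power is chosen so that t = root n Y satisfies |t| < \<rho>1.\<close>
  have "\<forall>\<^sub>F u in nhds 0. dist (snd u + p u) 0 < \<rho>1 ^ n"
    using \<rho>1 by (intro tendstoD) auto
  moreover have "\<forall>\<^sub>F u :: real \<times> real in nhds 0. u \<in> ball 0 (min rad \<rho>1)"
    using rad(1) \<rho>1 by (intro eventually_nhds_in_open) auto
  ultimately have "\<forall>\<^sub>F u in nhds 0. (((\<lambda>u. W (fst u) (snd u + p u)) has_derivative
        (\<lambda>w. Wx (fst u) (snd u + p u) * fst w + Wy (fst u) (snd u + p u) * (snd w + Dp u w))) (at u)) \<and>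
      (u \<noteq> 0 \<longrightarrow> 0 < W (fst u) (snd u + p u)) \<and>
      (u \<noteq> 0 \<longrightarrow> 0 < s * (Wx (fst u) (snd u + p u) * fst (planar_field p' q' u)
        + Wy (fst u) (snd u + p u) * (snd (planar_field p' q' u) + Dp u (planar_field p' q' u))))"
    using exp p' q'
  proof eventually_elim
    case (elim u)
    obtain x y where u: "u = (x, y)" by (cases u)
    define Y where "Y = y + p u"
    have xy: "fst u = x" "snd u = y" by (simp_all add: u)
    have u1: "u \<in> ball 0 rad" and u\<epsilon>: "u \<in> ball 0 \<epsilon>" and "norm u < \<rho>1" using elim(2) rad(2) by auto
    then have x: "\<bar>x\<bar> < \<rho>1" using norm_fst_le[of x y] by (simp add: u)
    have nu: "norm u \<le> 2 * (\<bar>x\<bar> + \<bar>Y\<bar>)" using elim(3) by (simp add: xy Y_def)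
    have Dp: "(p has_derivative Dp u) (at u)" by (rule C11_ball_has_derivative[OF p(1) u\<epsilon>])
    have "((\<lambda>u. (fst u, snd u + p u)) has_derivative (\<lambda>w. (fst w, snd w + Dp u w))) (at u)"
      by (intro derivative_intros Dp)
    from diff_chain_at[OF this, of "\<lambda>u. W (fst u) (snd u)"] DW
    have D: "((\<lambda>u. W (fst u) (snd u + p u)) has_derivative
        (\<lambda>w. Wx x Y * fst w + Wy x Y * (snd w + Dp u w))) (at u)"
      by (force simp: o_def xy Y_def)
    define t where "t = root n Y"
    have Yt: "Y = t ^ n" using n by (simp add: t_def odd_real_root_pow)
    define \<rho> where "\<rho> = max \<bar>x\<bar> \<bar>t\<bar>"
    have "\<bar>t\<bar> ^ n < \<rho>1 ^ n" using elim(1) by (simp add: xy Y_def[symmetric] Yt power_abs)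
    then have t: "\<bar>t\<bar> < \<rho>1" by (rule power_less_imp_less_base) (use \<rho>1 in simp)
    have \<rho>: "0 \<le> \<rho>" "\<rho> < \<rho>1" "\<bar>x\<bar> \<le> \<rho>" "\<bar>t\<bar> \<le> \<rho>" "\<rho> \<le> 1" using x t \<rho>1 by (auto simp: \<rho>_def)
    have "\<bar>Y\<bar> \<le> \<rho> ^ n" unfolding Yt power_abs using \<rho> by (intro power_mono) auto
    also have "\<dots> \<le> \<rho> ^ 1" using \<rho> n by (intro power_decreasing) auto
    finally have "\<bar>Y\<bar> \<le> \<rho>" by simp
    then have "2 * (\<bar>x\<bar> + \<bar>Y\<bar>) \<le> 2 * (\<rho> + \<rho>)" using \<rho>(3) by (intro mult_left_mono add_mono) auto
    with nu have nu4: "norm u \<le> 4 * \<rho>" by simp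
    have small: "\<bar>K\<bar> * norm u ^ (2 * n) \<le> K' * \<rho> ^ (2 * n)"
    proof -
      have "norm u ^ (2 * n) \<le> (4 * \<rho>) ^ (2 * n)" using nu4 by (intro power_mono) auto
      then have "\<bar>K\<bar> * norm u ^ (2 * n) \<le> \<bar>K\<bar> * (4 ^ (2 * n) * \<rho> ^ (2 * n))"
        by (intro mult_left_mono) (auto simp: power_mult_distrib)
      then show ?thesis by (simp add: K'_def)
    qed
    define e1 where "e1 = p' u - p u"
    define e2 where "e2 = q' u - q u"
    have "K * norm u ^ (2 * n) \<le> \<bar>K\<bar> * norm u ^ (2 * n)" by (intro mult_right_mono) auto
    then have e1: "\<bar>e1\<bar> \<le> K' * \<rho> ^ (2 * n)" and e2: "\<bar>e2\<bar> \<le> K' * \<rho> ^ (2 * n)"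
      using elim(4,5) small by (auto simp: e1_def e2_def)
    define py where "py = Dp u (0, 1)"
    define px where "px = Dp u (1, 0)"
    have "\<bar>py\<bar> \<le> L * norm u" "\<bar>px\<bar> \<le> L * norm u"
      using C11_ball_deriv_le[OF p u\<epsilon>, of "(0, 1)"] C11_ball_deriv_le[OF p u\<epsilon>, of "(1, 0)"]
      by (auto simp: py_def px_def norm_Pair)
    then have pxy: "\<bar>1 + py\<bar> \<le> 2" "\<bar>px\<bar> \<le> 1" using Lnorm_le[OF u1] by linarith+
    define E0 where "E0 = (1 + py) * q u + px * Y - (a * x ^ (2 * n - 1) + b * x ^ (n - 1) * Y)"
    have E0: "\<bar>E0\<bar> \<le> 3 * C1 * \<rho> ^ (2 * n)"
    proof -
      have "\<bar>E0\<bar> \<le> C1 * (\<bar>x\<bar> ^ (2 * n) + \<bar>x\<bar> ^ n * \<bar>Y\<bar> + Y ^ 2)"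
        using elim(3) by (simp only: xy Y_def E0_def px_def py_def)
      also have "\<dots> \<le> C1 * (\<rho> ^ (2 * n) + \<rho> ^ n * \<rho> ^ n + (\<rho> ^ n) ^ 2)"
      proof -
        have Y: "\<bar>Y\<bar> \<le> \<rho> ^ n" unfolding Yt power_abs using \<rho> by (intro power_mono) auto
        then have Y2: "Y ^ 2 \<le> (\<rho> ^ n) ^ 2" by (metis abs_ge_zero power2_abs power_mono)
        have "\<bar>x\<bar> ^ i \<le> \<rho> ^ i" for i using \<rho>(3) by (intro power_mono) auto
        then show ?thesis using Y \<rho>(1) C1 by (intro mult_left_mono add_mono mult_mono Y2) auto
      qed
      also have "\<dots> = 3 * C1 * \<rho> ^ (2 * n)"
        unfolding power2_eq_square[of "\<rho> ^ n"] power_add[symmetric] mult_2[symmetric] by simp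
      finally show ?thesis .
    qed
    define E2 where "E2 = E0 + (1 + py) * e2 + px * e1"
    have "\<bar>(1 + py) * e2\<bar> \<le> 2 * (K' * \<rho> ^ (2 * n))" "\<bar>px * e1\<bar> \<le> 1 * (K' * \<rho> ^ (2 * n))"
      unfolding abs_mult using mult_mono[OF pxy(1) e2] mult_mono[OF pxy(2) e1] by simp_all
    then have E2: "\<bar>E2\<bar> \<le> C * \<rho> ^ (2 * n)"
      using E0 abs_triangle_ineq[of "E0 + (1 + py) * e2" "px * e1"] abs_triangle_ineq[of E0 "(1 + py) * e2"]
      unfolding E2_def C_def distrib_right by simp
    have "K' * \<rho> ^ (2 * n) \<le> C * \<rho> ^ (2 * n)" using C \<rho> by (intro mult_right_mono) auto
    then have E1: "\<bar>e1\<bar> \<le> C * \<rho> ^ (2 * n)" using e1 by linarith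
    have X: "planar_field p' q' u = (Y + e1, q' u)" by (simp add: planar_field_def u Y_def e1_def)
    have lin: "linear (Dp u)" using Dp by (rule has_derivative_linear)
    have "Dp u (Y + e1, q' u) = Dp u ((Y + e1) *\<^sub>R (1, 0) + q' u *\<^sub>R (0, 1))" by simp
    also have "\<dots> = (Y + e1) * px + q' u * py"
      unfolding linear_add[OF lin] linear_scale[OF lin] px_def py_def by simp
    finally have snd_eq: "q' u + Dp u (Y + e1, q' u) = b * x ^ (n - 1) * t ^ n - (- a) * x ^ (2 * n - 1) + E2"
      unfolding E2_def E0_def e2_def Yt[symmetric] by (simp add: algebra_simps)
    have pos_inc: "0 < W x Y" "0 < s * (Wx x Y * (Y + e1) + Wy x Y * (q' u + Dp u (Y + e1, q' u)))" if "u \<noteq> 0"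
    proof -
      have nz: "x \<noteq> 0 \<or> t \<noteq> 0"
      proof (rule ccontr)
        assume "\<not> (x \<noteq> 0 \<or> t \<noteq> 0)"
        then have "x = 0" "Y = 0" using n by (auto simp: Yt)
        with nu that show False by simp
      qed
      then show "0 < W x Y" by (intro Wpos) (auto simp: Yt)
      show "0 < s * (Wx x Y * (Y + e1) + Wy x Y * (q' u + Dp u (Y + e1, q' u)))"
        unfolding snd_eq
        using Winc[OF nz, of e1 E2] E1 E2 \<rho> \<rho>1 unfolding \<rho>_def[symmetric] by (simp add: Yt)
    qed
    show ?case
      using D pos_inc unfolding xy Y_def[symmetric] X fst_conv snd_conv by blast
  qed
  then obtain \<delta> where "\<delta> > 0" and \<delta>: "\<And>u. dist u 0 < \<delta> \<Longrightarrow>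
      (((\<lambda>u. W (fst u) (snd u + p u)) has_derivative
        (\<lambda>w. Wx (fst u) (snd u + p u) * fst w + Wy (fst u) (snd u + p u) * (snd w + Dp u w))) (at u)) \<and>
      (u \<noteq> 0 \<longrightarrow> 0 < W (fst u) (snd u + p u)) \<and>
      (u \<noteq> 0 \<longrightarrow> 0 < s * (Wx (fst u) (snd u + p u) * fst (planar_field p' q' u)
        + Wy (fst u) (snd u + p u) * (snd (planar_field p' q' u) + Dp u (planar_field p' q' u))))"
    unfolding eventually_nhds_metric by blast
  show ?thesis
  proof (rule not_center_of_lyapunov[OF s, of "\<delta> / 2" "\<lambda>u. W (fst u) (snd u + p u)"
        "\<lambda>u w. Wx (fst u) (snd u + p u) * fst w + Wy (fst u) (snd u + p u) * (snd w + Dp u w)"])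
    show "0 < \<delta> / 2" using \<open>\<delta> > 0\<close> by simp
    show "W (fst 0) (snd 0 + p 0) = 0" using W0 \<open>p 0 = 0\<close> by simp
    fix u :: "real \<times> real" assume "u \<in> cball 0 (\<delta> / 2)"
    then have "dist u 0 < \<delta>" using \<open>\<delta> > 0\<close> by simp
    note * = \<delta>[OF this]
    show "((\<lambda>u. W (fst u) (snd u + p u)) has_derivative
        (\<lambda>w. Wx (fst u) (snd u + p u) * fst w + Wy (fst u) (snd u + p u) * (snd w + Dp u w))) (at u)"
      using * by blast
    assume "u \<noteq> 0"
    with * show "0 < W (fst u) (snd u + p u)"
      "0 < s * (Wx (fst u) (snd u + p u) * fst (planar_field p' q' u)
        + Wy (fst u) (snd u + p u) * (snd (planar_field p' q' u) + Dp u (planar_field p' q' u)))"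
      by blast+
  qed
qed

end

theorem theorem35:
  fixes lam a b :: real
    and P Q R :: "real \<times> real \<times> real \<Rightarrow> real"
    and U :: "(real \<times> real \<times> real) set"
    and h h' :: "real \<times> real \<Rightarrow> real"
    and V V' :: "(real \<times> real) set"
    and F :: "real \<Rightarrow> real"
    and r n \<alpha> \<beta> :: nat
  assumes "lam \<noteq> 0"
    and "open U" and "0 \<in> U"
    and "real_analytic_on3 P U" and "real_analytic_on3 Q U" and "real_analytic_on3 R U"
    and "zero_1_jet P" and "zero_1_jet Q" and "zero_1_jet R"
    and "center_manifold (field3 lam P Q R) U r h V"
    and "monodromic (planar_field (restrict_to h P) (restrict_to h Q)) V"
    and "solves_branch (restrict_to h P) F"
    and "leading_term (f_along (restrict_to h Q) F) a \<alpha>" and "\<alpha> < r"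
    and "leading_term (Phi_along (restrict_to h P) (restrict_to h Q) F) b \<beta>"
    and "a < 0" and "\<alpha> = 2 * n - 1"
    and "\<beta> = n - 1" and "b\<^sup>2 + 4 * a * real n < 0"
    and "odd n"
    and "center_manifold (field3 lam P Q R) U r h' V'"
  shows "\<not> is_center (planar_field (restrict_to h' P) (restrict_to h' Q)) V'"
proof -
  have "0 < n" using \<open>odd n\<close> by (rule odd_pos)
  \<comment> \<open>From n > 0 follows \<alpha> \<ge> 1, so r \<ge> 2 and \<open>h\<close> is at
    least C^2, as a Lipschitz derivative requires.\<close>
  then have "r = Suc (Suc (r - 2))" using \<open>\<alpha> = 2 * n - 1\<close> \<open>\<alpha> < r\<close> by linarith
  then obtain k where r: "r = Suc (Suc k)" ..
  note h = \<open>center_manifold (field3 lam P Q R) U r h V\<close>[unfolded r]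
    and h' = \<open>center_manifold (field3 lam P Q R) U r h' V'\<close>[unfolded r]
  note jets = \<open>zero_1_jet P\<close> \<open>zero_1_jet Q\<close> \<open>zero_1_jet R\<close>
  obtain DP DQ DR where PQR: "C11_near_0 P DP" "C11_near_0 Q DQ" "C11_near_0 R DR"
    using assms(4-6)[THEN real_analytic_C11, OF \<open>0 \<in> U\<close>] by blast
  have jet: "zero_1_jet h" "zero_1_jet h'" using h h' by (auto simp: center_manifold_def)
  have "Ck_on (Suc (Suc k)) h V" "open V" "0 \<in> V" using h by (auto simp: center_manifold_def)
  then obtain Dh where Dh: "C11_near_0 h Dh" using C2_imp_C11 by blast
  obtain \<epsilon> L where B: "C11_ball \<epsilon> L (restrict_to h P) (\<lambda>u w. DP (fst u, snd u, h u) (fst w, snd w, Dh u w))"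
    "C11_ball \<epsilon> L (restrict_to h Q) (\<lambda>u w. DQ (fst u, snd u, h u) (fst w, snd w, Dh u w))"
    by (rule C11_ball_common[OF C11_restrict_to[OF Dh jet(1) PQR(1) jets(1)]
          C11_restrict_to[OF Dh jet(1) PQR(2) jets(2)]])
  interpret planar_branch "restrict_to h P" "restrict_to h Q"
    "\<lambda>u w. DP (fst u, snd u, h u) (fst w, snd w, Dh u w)"
    "\<lambda>u w. DQ (fst u, snd u, h u) (fst w, snd w, Dh u w)" F \<epsilon> L
    by unfold_locales (use B zero_1_jet_restrict_to jet jets \<open>solves_branch (restrict_to h P) F\<close> in auto)
  note f = \<open>leading_term (f_along (restrict_to h Q) F) a \<alpha>\<close>[unfolded \<open>\<alpha> = 2 * n - 1\<close>]
    and \<Phi> = \<open>leading_term (Phi_along (restrict_to h P) (restrict_to h Q) F) b \<beta>\<close>[unfolded \<open>\<beta> = n - 1\<close>]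
  have "n \<noteq> 1" using \<Phi> Phi_along_no_constant_term[of b] by auto
  then have "1 < n" using \<open>odd n\<close> by (cases n) auto
  \<comment> \<open>The flatness order 2n is the weight that the Lyapunov function tolerates as an
    error.\<close>
  obtain C where C: "C \<ge> 0" "\<forall>\<^sub>F u in nhds 0. \<bar>h' u - h u\<bar> \<le> C * norm u ^ (2 * n)"
    by (rule center_manifolds_agree[OF \<open>lam \<noteq> 0\<close> PQR jets h h'])
  have diff: "\<forall>\<^sub>F u in nhds 0. \<bar>restrict_to h' G u - restrict_to h G u\<bar> \<le> C * norm u ^ (2 * n)"
    if "C11_near_0 G D" "zero_1_jet G" for G D
    using restrict_to_diff_small[OF that jet zero_less_one] C(2) by eventually_elim simp
  show ?thesis
    by (rule perturbed_field_not_center[OF f \<Phi> \<open>odd n\<close> \<open>1 < n\<close> \<open>a < 0\<close>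
          diff[OF PQR(1) jets(1)] diff[OF PQR(2) jets(2)]])
qed

end
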